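(* Let $\mathcal{G}$ be a class of graphs. The following are equivalent. \begin{itemize} \item There is a constant $C$ such that $\operatorname{diam}(\mathcal{I}(G)) \leq C$ for every $G \in \mathcal{G}$. \item There is a constant $C_s$ such that $\chi_s(G) \leq C_s$ for every $G \in \mathcal{G}$. \item There is a constant $C_a$ such that $\chi_a(G) \leq C_a$ for every $G \in \mathcal{G}$. \item There is a constant $C_o$ such that $\chi_o(G) \leq C_o$ for every $G \in \mathcal{G}$. \end{itemize}
   Context: Graphs are finite and simple. In an orientation $\vec{G}$ of a graph $G$, the inversion of a set $X \subseteq V(G)$ consists in reversing all arcs with both endvertices in $X$. The inversion graph $\mathcal{I}(G)$ is the graph whose vertices are the labelled orientations of $G$, two orientations being adjacent if and only if the inversion of some $X\subseteq V(G)$ transforms one into the other; $\operatorname{diam}(\mathcal{I}(G))$ is its diameter. A star-forest is a forest whose components have diameter at most $2$. The star chromatic number $\chi_s(G)$ (resp. acyclic chromatic number $\chi_a(G)$) of a graph $G$ is the least integer $k$ such that $G$ has a proper $k$-vertex-colouring in which any union of two colour classes induces a star-forest (resp. a forest). The oriented chromatic number $\chi_o(D)$ of an oriented graph $D$ is the minimum integer $k$ for which there exists a proper colouring $\phi : V(D) \to \{1,\dots,k\}$ such that for all $i,j \in \{1,\dots,k\}$, the arcs linking $\phi^{-1}(i)$ and $\phi^{-1}(j)$ are either all oriented from $\phi^{-1}(i)$ to $\phi^{-1}(j)$ or all oriented from $\phi^{-1}(j)$ to $\phi^{-1}(i)$. The oriented chromatic number $\chi_o(G)$ of a graph $G$ is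 the maximum of $\chi_o(\vec{G})$ over all orientations $\vec{G}$ of $G$. *)

theory Defs
  imports "Graph_Theory.Graph_Theory"
begin

text \<open>
  A finite simple graph is a symmetric loop-free finite digraph, that is, a
  \<^typ>\<open>'a pair_pre_digraph\<close> \<open>G\<close> with \<^prop>\<open>pair_graph G\<close>; the edge \<open>uv\<close> is the pair of
  arcs \<open>(u, v)\<close>, \<open>(v, u)\<close>.
\<close>

section \<open>Distance and forests\<close>

text \<open>
  The distance of \<open>u\<close> and \<open>v\<close> is the weighted distance \<open>\<mu>\<close> with unit weights; it is
  \<open>\<infinity>\<close> if \<open>v\<close> is not reachable from \<open>u\<close>.
\<close>

definition (in wf_digraph) diameter :: ereal where
  "diameter = (SUP u\<in>verts G. SUP v\<in>verts G. \<mu> (\<lambda>_. 1) u v)"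

text \<open>
  In a symmetric digraph every edge \<open>uv\<close> yields a directed cycle of length two, so
  \<^const>\<open>forest\<close> is not the right notion for undirected graphs. The cycles of
  the undirected graph are the directed cycles of length at least three.
\<close>

definition undirected_forest :: "('a, 'b) pre_digraph \<Rightarrow> bool" where
  "undirected_forest G \<longleftrightarrow> \<not> (\<exists>p. pre_digraph.cycle G p \<and> length p \<ge> 3)"

text \<open>In a symmetric digraph the connected components are the strongly connected ones.\<close>

definition star_forest :: "('a, 'b) pre_digraph \<Rightarrow> bool" where
  "star_forest G \<longleftrightarrow>
     undirected_forest G \<and> (\<forall>H \<in> pre_digraph.sccs G. wf_digraph.diameter H \<le> 2)"

section \<open>Colourings\<close>

definition proper_colouring :: "'a pair_pre_digraph \<Rightarrow> nat \<Rightarrow> ('a \<Rightarrow> nat) \<Rightarrow> bool" where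
  "proper_colouring G k \<phi> \<longleftrightarrow>
     (\<forall>v \<in> pverts G. \<phi> v \<in> {1..k}) \<and> (\<forall>(u, v) \<in> parcs G. \<phi> u \<noteq> \<phi> v)"

definition colour_class :: "'a pair_pre_digraph \<Rightarrow> ('a \<Rightarrow> nat) \<Rightarrow> nat \<Rightarrow> 'a set" where
  "colour_class G \<phi> i = {v \<in> pverts G. \<phi> v = i}"

definition star_colouring :: "'a pair_pre_digraph \<Rightarrow> nat \<Rightarrow> ('a \<Rightarrow> nat) \<Rightarrow> bool" where
  "star_colouring G k \<phi> \<longleftrightarrow> proper_colouring G k \<phi> \<and>
     (\<forall>i \<in> {1..k}. \<forall>j \<in> {1..k}. i \<noteq> j \<longrightarrow>
        star_forest (with_proj G \<restriction> (colour_class G \<phi> i \<union> colour_class G \<phi> j)))"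

definition acyclic_colouring :: "'a pair_pre_digraph \<Rightarrow> nat \<Rightarrow> ('a \<Rightarrow> nat) \<Rightarrow> bool" where
  "acyclic_colouring G k \<phi> \<longleftrightarrow> proper_colouring G k \<phi> \<and>
     (\<forall>i \<in> {1..k}. \<forall>j \<in> {1..k}. i \<noteq> j \<longrightarrow>
        undirected_forest (with_proj G \<restriction> (colour_class G \<phi> i \<union> colour_class G \<phi> j)))"

definition star_chromatic_number :: "'a pair_pre_digraph \<Rightarrow> nat" where
  "star_chromatic_number G = (LEAST k. \<exists>\<phi>. star_colouring G k \<phi>)"

definition acyclic_chromatic_number :: "'a pair_pre_digraph \<Rightarrow> nat" where
  "acyclic_chromatic_number G = (LEAST k. \<exists>\<phi>. acyclic_colouring G k \<phi>)"

section \<open>Orientations and the oriented chromatic number\<close>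

definition orientations :: "'a pair_pre_digraph \<Rightarrow> 'a pair_pre_digraph set" where
  "orientations G = {D. pverts D = pverts G \<and>
     parcs D \<union> (parcs D)\<inverse> = parcs G \<and> parcs D \<inter> (parcs D)\<inverse> = {}}"

definition arcs_linking :: "'a pair_pre_digraph \<Rightarrow> 'a set \<Rightarrow> 'a set \<Rightarrow> ('a \<times> 'a) set" where
  "arcs_linking D A B = parcs D \<inter> (A \<times> B \<union> B \<times> A)"

definition oriented_colouring :: "'a pair_pre_digraph \<Rightarrow> nat \<Rightarrow> ('a \<Rightarrow> nat) \<Rightarrow> bool" where
  "oriented_colouring D k \<phi> \<longleftrightarrow> proper_colouring D k \<phi> \<and>
     (\<forall>i \<in> {1..k}. \<forall>j \<in> {1..k}.
        let A = colour_class D \<phi> i; B = colour_class D \<phi> j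
        in arcs_linking D A B \<subseteq> A \<times> B \<or> arcs_linking D A B \<subseteq> B \<times> A)"

definition oriented_chromatic_number_digraph :: "'a pair_pre_digraph \<Rightarrow> nat" where
  "oriented_chromatic_number_digraph D = (LEAST k. \<exists>\<phi>. oriented_colouring D k \<phi>)"

definition oriented_chromatic_number :: "'a pair_pre_digraph \<Rightarrow> nat" where
  "oriented_chromatic_number G = Max (oriented_chromatic_number_digraph ` orientations G)"

section \<open>The inversion graph\<close>

definition inversion :: "'a set \<Rightarrow> 'a pair_pre_digraph \<Rightarrow> 'a pair_pre_digraph" where
  "inversion X D = \<lparr> pverts = pverts D,
     parcs = {(u, v). if u \<in> X \<and> v \<in> X then (v, u) \<in> parcs D else (u, v) \<in> parcs D} \<rparr>"

text \<open>
  Inverting the empty set fixes every orientation; the condition \<open>D \<noteq> D'\<close> keeps the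
  inversion graph simple.
\<close>

definition inversion_graph :: "'a pair_pre_digraph \<Rightarrow> 'a pair_pre_digraph pair_pre_digraph" where
  "inversion_graph G = \<lparr> pverts = orientations G,
     parcs = {(D, D'). D \<in> orientations G \<and> D' \<in> orientations G \<and> D \<noteq> D' \<and>
                (\<exists>X \<subseteq> pverts G. inversion X D = D')} \<rparr>"

section \<open>Well-definedness\<close>

lemma finite_orientations:
  assumes "pair_graph G" shows "finite (orientations G)"
proof -
  interpret pair_graph G by fact
  have "orientations G \<subseteq> (\<lambda>A. \<lparr> pverts = pverts G, parcs = A \<rparr>) ` Pow (parcs G)"
  proof
    fix D assume D: "D \<in> orientations G"
    then have "D = \<lparr> pverts = pverts G, parcs = parcs D \<rparr>" "parcs D \<in> Pow (parcs G)"
      by (auto simp: orientations_def)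
    then show "D \<in> (\<lambda>A. \<lparr> pverts = pverts G, parcs = A \<rparr>) ` Pow (parcs G)"
      by blast
  qed
  then show ?thesis
    using pair_finite_arcs finite_subset by blast
qed

lemma orientations_nonempty:
  assumes "pair_graph G" shows "orientations G \<noteq> {}"
proof -
  interpret pair_graph G by fact
  obtain f :: "'a \<Rightarrow> nat" where f: "inj_on f (pverts G)"
    using finite_imp_inj_to_nat_seg[OF pair_finite_verts] by blast
  define A where "A = {(u, v) \<in> parcs G. f u < f v}"
  have sym: "(v, u) \<in> parcs G" if "(u, v) \<in> parcs G" for u v
    using pair_sym_arcs that by (auto simp: symmetric_def sym_def)
  have lin: "f u < f v \<or> f v < f u" if "(u, v) \<in> parcs G" for u v
    using f that pair_no_loops[OF that] in_arcsD1[OF that] in_arcsD2[OF that]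
    by (metis fst_conv inj_onD linorder_neqE_nat snd_conv)
  have "A \<union> A\<inverse> = parcs G" "A \<inter> A\<inverse> = {}"
    using sym lin by (auto simp: A_def)
  then have "\<lparr> pverts = pverts G, parcs = A \<rparr> \<in> orientations G"
    by (simp add: orientations_def)
  then show ?thesis by blast
qed

lemma inversion_inversion: "inversion X (inversion X D) = D"
  by (cases D) (auto simp: inversion_def)

lemma pair_graph_inversion_graph:
  assumes "pair_graph G" shows "pair_graph (inversion_graph G)"
proof -
  have fin: "finite (orientations G)" by (rule finite_orientations[OF assms])
  have "parcs (inversion_graph G) \<subseteq> orientations G \<times> orientations G"
    by (auto simp: inversion_graph_def)
  then have fin': "finite (parcs (inversion_graph G))"
    using fin finite_subset by blast
  have "sym (parcs (inversion_graph G))"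
    by (rule symI) (auto simp: inversion_graph_def inversion_inversion)
  then show ?thesis
    by unfold_locales
      (use fin fin' in \<open>auto simp: symmetric_def inversion_graph_def\<close>)
qed

end

theory Submission
  imports Defs
begin

text \<open>
  Call an assignment of codes to the vertices an encoding of an edge labelling if a fixed decoding
  function recovers the label of every edge from the codes of its endvertices. All four parameters
  control the number \<open>N\<close> of codes that suffices for every \<open>0\<close>-\<open>1\<close> labelling of the edges.
  If the inversion graph has diameter \<open>C\<close>, then \<open>2 ^ C\<close> codes suffice: a vertex
  records in which of the at most \<open>C\<close> inverted sets it lies. If the oriented chromatic number is bounded,
  a vertex records its colours in two oriented colourings, one of a reference orientation and one of
  the orientation reversed according to the labels.

  Conversely, counting labellings shows that encodability with \<open>N\<close> codes forces
  \<open>2 * N\<close>-degeneracy, hence a proper colouring and an orientation of small indegree. A proper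
  colouring combined with an encoding is an oriented colouring, and the
  encodings of finitely many labellings combine to a star colouring. A star colouring is acyclic, and in an
  acyclic colouring the edges between two colour classes form a forest, on which two inversions
  reverse any prescribed set of edges. This closes the cycle
  \<open>\<chi>\<^sub>s \<rightarrow> \<chi>\<^sub>a \<rightarrow> diam \<rightarrow> \<chi>\<^sub>o \<rightarrow> \<chi>\<^sub>s\<close>.
\<close>

section \<open>Degenerate graphs\<close>

text \<open>Quantifying over all subsets, instead of fixing an elimination order, suits the counting
  and longest-path arguments; the order is recovered by \<open>degenerate_induct\<close>.\<close>

definition degenerate :: "'a rel \<Rightarrow> 'a set \<Rightarrow> nat \<Rightarrow> bool" where
  "degenerate E V d \<longleftrightarrow> (\<forall>W\<subseteq>V. W \<noteq> {} \<longrightarrow> (\<exists>v\<in>W. card {u \<in> W. (u, v) \<in> E} \<le> d))"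

text \<open>Repeatedly deleting a vertex of small degree in the remaining set empties
  \<open>V\<close>; read backwards, every inserted vertex meets at most \<open>d\<close>
  predecessors among those already present.\<close>

lemma degenerate_induct [consumes 2, case_names empty insert]:
  assumes "finite V" "degenerate E V d"
    and "P {}"
    and step: "\<And>v W. v \<notin> W \<Longrightarrow> finite W \<Longrightarrow> insert v W \<subseteq> V \<Longrightarrow>
                 card {u \<in> W. (u, v) \<in> E} \<le> d \<Longrightarrow> P W \<Longrightarrow> P (insert v W)"
  shows "P V"
proof -
  have "P W" if "W \<subseteq> V" for W
    using finite_subset[OF that \<open>finite V\<close>] that
  proof (induction W rule: finite_psubset_induct)
    case (psubset W)
    show ?case
    proof (cases "W = {}")
      case False
      then obtain v where v: "v \<in> W" "card {u \<in> W. (u, v) \<in> E} \<le> d"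
        using assms(2) psubset.prems unfolding degenerate_def by blast
      have "card {u \<in> W - {v}. (u, v) \<in> E} \<le> card {u \<in> W. (u, v) \<in> E}"
        using psubset.hyps by (intro card_mono) auto
      with v psubset step[of v "W - {v}"] show ?thesis
        by (auto simp: insert_absorb)
    qed (use assms in simp)
  qed
  then show ?thesis by blast
qed

text \<open>Greedy colouring: at most \<open>d\<close> of the \<open>d + 1\<close> colours are
  blocked when \<open>v\<close> is inserted.\<close>

lemma degenerate_imp_proper_colouring:
  assumes "finite V" "degenerate E V d" "sym E" "irrefl E"
  shows "\<exists>c :: 'a \<Rightarrow> nat. c ` V \<subseteq> {..d} \<and> (\<forall>u\<in>V. \<forall>v\<in>V. (u, v) \<in> E \<longrightarrow> c u \<noteq> c v)"
  using assms(1,2)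
proof (induction rule: degenerate_induct)
  case (insert v W)
  from insert.IH obtain c :: "'a \<Rightarrow> nat"
    where c: "c ` W \<subseteq> {..d}" "\<forall>u\<in>W. \<forall>w\<in>W. (u, w) \<in> E \<longrightarrow> c u \<noteq> c w"
    by (elim exE conjE)
  have "card (c ` {u \<in> W. (u, v) \<in> E}) < card {..d}"
    using card_image_le[of "{u \<in> W. (u, v) \<in> E}" c] insert by simp
  then have "\<not> {..d} \<subseteq> c ` {u \<in> W. (u, v) \<in> E}"
    using card_mono[of "c ` {u \<in> W. (u, v) \<in> E}" "{..d}"] insert.hyps by auto
  then obtain a where a: "a \<le> d" "a \<notin> c ` {u \<in> W. (u, v) \<in> E}" by blast
  have "(u, v) \<in> E \<longleftrightarrow> (v, u) \<in> E" "(u, u) \<notin> E" for u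
    using assms(3,4) by (auto simp: sym_def irrefl_def)
  with a c insert(1) show ?case
    by (intro exI[of _ "c(v := a)"]) (auto simp: image_subset_iff)
qed simp

text \<open>Every edge points to the endvertex inserted later, so the indegree of a vertex is
  settled at its insertion.\<close>

lemma degenerate_imp_orientation:
  assumes "finite V" "degenerate E V d" "sym E" "irrefl E"
  shows "\<exists>D. D \<union> D\<inverse> = E \<inter> V \<times> V \<and> D \<inter> D\<inverse> = {} \<and> (\<forall>v. card {u. (u, v) \<in> D} \<le> d)"
  using assms(1,2)
proof (induction rule: degenerate_induct)
  case empty
  show ?case by (intro exI[of _ "{}"]) auto
next
  case (insert v W)
  then obtain D where D: "D \<union> D\<inverse> = E \<inter> W \<times> W" "D \<inter> D\<inverse> = {}" "\<And>w. card {u. (u, w) \<in> D} \<le> d"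
    by blast
  let ?D = "D \<union> {u \<in> W. (u, v) \<in> E} \<times> {v}"
  have DW: "D \<subseteq> W \<times> W" using D(1) by blast
  have *: "(u, v) \<in> E \<longleftrightarrow> (v, u) \<in> E" "(u, u) \<notin> E" for u
    using assms(3,4) by (auto simp: sym_def irrefl_def)
  have "?D \<union> ?D\<inverse> = (D \<union> D\<inverse>) \<union> ({u \<in> W. (u, v) \<in> E} \<times> {v} \<union> {v} \<times> {u \<in> W. (u, v) \<in> E})"
    by auto
  also have "\<dots> = E \<inter> insert v W \<times> insert v W"
    unfolding D(1) using * by auto
  finally have 1: "?D \<union> ?D\<inverse> = E \<inter> insert v W \<times> insert v W" .
  have 2: "?D \<inter> ?D\<inverse> = {}" using D(2) DW insert(1) by blast
  have 3: "card {u. (u, w) \<in> ?D} \<le> d" for w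
  proof (cases "w = v")
    case True
    then have "{u. (u, w) \<in> ?D} = {u \<in> W. (u, v) \<in> E}" using DW insert(1) by auto
    then show ?thesis using insert by simp
  qed (use D(3)[of w] in simp)
  show ?case by (rule exI[of _ ?D]) (intro conjI allI 1 2 3)
qed

text \<open>
  Membership in \<open>X\<close> and \<open>Y\<close> is a nonzero vector of \<open>GF(2)\<^sup>2\<close> at every vertex. The induction works because
  a nonzero vector takes both values \<open>0\<close> and \<open>1\<close> as inner product with nonzero vectors.
\<close>

lemma degenerate_1_imp_two_inversions:
  assumes "finite V" "degenerate E V 1" "sym E" "irrefl E" and "sym S"
  shows "\<exists>X Y. X \<union> Y = V \<and>
     (\<forall>u\<in>V. \<forall>v\<in>V. (u, v) \<in> E \<longrightarrow> ((u, v) \<in> S \<longleftrightarrow> (u \<in> X \<and> v \<in> X) \<noteq> (u \<in> Y \<and> v \<in> Y)))"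
  using assms(1,2)
proof (induction rule: degenerate_induct)
  case empty
  show ?case by simp
next
  case (insert v W)
  then obtain X Y where XY: "X \<union> Y = W"
    "\<And>u w. u \<in> W \<Longrightarrow> w \<in> W \<Longrightarrow> (u, w) \<in> E \<Longrightarrow> (u, w) \<in> S \<longleftrightarrow> (u \<in> X \<and> w \<in> X) \<noteq> (u \<in> Y \<and> w \<in> Y)"
    by blast
  have symE: "(u, v) \<in> E \<longleftrightarrow> (v, u) \<in> E" "(u, u) \<notin> E" "(u, v) \<in> S \<longleftrightarrow> (v, u) \<in> S" for u
    using assms by (auto simp: sym_def irrefl_def)
  \<comment> \<open>The only possible neighbour of \<open>v\<close> in \<open>W\<close>; any value
    will do if there is none.\<close>
  obtain w where w: "\<And>u. u \<in> W \<Longrightarrow> (u, v) \<in> E \<Longrightarrow> u = w"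
  proof (cases "\<exists>w\<in>W. (w, v) \<in> E")
    case True
    then obtain w where "w \<in> W" "(w, v) \<in> E" by blast
    with insert(2,4) show thesis by (intro that[of w]) (auto simp: card_le_Suc0_iff_eq)
  qed (use that in blast)
  \<comment> \<open>\<open>p\<close> and \<open>q\<close> decide whether \<open>v\<close> joins
    \<open>X\<close> and \<open>Y\<close>. The choice (1, 0) gives the edge the value
    \<open>w \<in> X\<close>. If this is wrong, (\<open>w \<in> Y\<close>, 1) gives the opposite
    value: for \<open>w \<in> Y\<close> the second term flips it, and otherwise
    \<open>w \<in> X\<close> and both terms vanish.\<close>
  obtain p q where pq: "p \<or> q"
    "w \<in> W \<Longrightarrow> (w, v) \<in> S \<longleftrightarrow> (w \<in> X \<and> p) \<noteq> (w \<in> Y \<and> q)"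
  proof (cases "(w \<in> X) = ((w, v) \<in> S)")
    case True
    then show thesis using that[of True False] by auto
  next
    case False
    then show thesis using that[of "w \<in> Y" True] XY(1) by auto
  qed
  let ?X = "if p then insert v X else X" and ?Y = "if q then insert v Y else Y"
  have v: "v \<in> ?X \<longleftrightarrow> p" "v \<in> ?Y \<longleftrightarrow> q" and W: "u \<in> W \<Longrightarrow> u \<in> ?X \<longleftrightarrow> u \<in> X" "u \<in> W \<Longrightarrow> u \<in> ?Y \<longleftrightarrow> u \<in> Y" for u
    using insert(1) XY(1) by auto
  have "?X \<union> ?Y = insert v W" using XY(1) pq(1) by auto
  moreover have "(u, x) \<in> S \<longleftrightarrow> (u \<in> ?X \<and> x \<in> ?X) \<noteq> (u \<in> ?Y \<and> x \<in> ?Y)"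
    if ux: "u \<in> insert v W" "x \<in> insert v W" "(u, x) \<in> E" for u x
  proof -
    consider "u \<in> W" "x \<in> W" | "u = v" "x \<in> W" | "u \<in> W" "x = v"
      using ux symE(2) by blast
    then show ?thesis
    proof cases
      case 1
      then show ?thesis using XY(2)[OF _ _ ux(3)] W by simp
    next
      case 2
      then have "x = w" using w ux(3) symE(1) by simp
      then show ?thesis using 2 pq(2) symE(3) W[OF \<open>x \<in> W\<close>] v by auto
    next
      case 3
      then have "u = w" using w ux(3) by simp
      then show ?thesis using 3 pq(2) W[OF \<open>u \<in> W\<close>] v by simp
    qed
  qed
  ultimately show ?case by (intro exI[of _ ?X] exI[of _ ?Y] conjI ballI impI)
qed

section \<open>Encoding edge labellings by vertex colours\<close>

text \<open>The decoder precedes the labelling in the quantifiers, so that \<open>f\<close> alone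
  determines \<open>S\<close>. Symmetry of \<open>S\<close> makes it a set of undirected
  edges.\<close>

definition edge_encodable :: "'a set \<Rightarrow> 'a rel \<Rightarrow> nat \<Rightarrow> bool" where
  "edge_encodable V E N \<longleftrightarrow> (\<exists>dec :: nat \<Rightarrow> nat \<Rightarrow> bool. \<forall>S\<subseteq>E. sym S \<longrightarrow>
     (\<exists>f. f ` V \<subseteq> {..<N} \<and> (\<forall>(u, v)\<in>E. (u, v) \<in> S \<longleftrightarrow> dec (f u) (f v))))"

text \<open>Only the number of codes matters: codes from any finite set \<open>Q\<close> are
  replaced by numbers through an enumeration of \<open>Q\<close>.\<close>

lemma edge_encodableI:
  assumes "finite Q" "card Q \<le> N" "E \<subseteq> V \<times> V"
    and "\<And>S. S \<subseteq> E \<Longrightarrow> sym S \<Longrightarrow> \<exists>f. f ` V \<subseteq> Q \<and> (\<forall>(u, v)\<in>E. (u, v) \<in> S \<longleftrightarrow> dec (f u) (f v))"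
  shows "edge_encodable V E N"
proof -
  obtain g where g: "bij_betw g Q {0..<card Q}"
    using ex_bij_betw_finite_nat[OF assms(1)] by blast
  let ?dec = "\<lambda>i j. dec (inv_into Q g i) (inv_into Q g j)"
  have "\<exists>f. f ` V \<subseteq> {..<N} \<and> (\<forall>(u, v)\<in>E. (u, v) \<in> S \<longleftrightarrow> ?dec (f u) (f v))"
    if S: "S \<subseteq> E" "sym S" for S
  proof -
    obtain f where f: "f ` V \<subseteq> Q" "\<forall>(u, v)\<in>E. (u, v) \<in> S \<longleftrightarrow> dec (f u) (f v)"
      using assms(4)[OF S] by blast
    have "g (f v) < N" "inv_into Q g (g (f v)) = f v" if "v \<in> V" for v
    proof -
      have "f v \<in> Q" using f(1) that by blast
      then show "g (f v) < N" "inv_into Q g (g (f v)) = f v"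
        using bij_betwE[OF g] assms(2) bij_betw_inv_into_left[OF g] by fastforce+
    qed
    then have "(g \<circ> f) ` V \<subseteq> {..<N} \<and> (\<forall>(u, v)\<in>E. (u, v) \<in> S \<longleftrightarrow> ?dec ((g \<circ> f) u) ((g \<circ> f) v))"
      using f(2) assms(3) by (auto 0 3)
    then show ?thesis by blast
  qed
  then show ?thesis unfolding edge_encodable_def by (intro exI[of _ ?dec]) blast
qed

text \<open>With \<open>d\<close> the number of all vertices, degeneracy is automatic.\<close>

lemma ex_orientation:
  assumes "finite V" "E \<subseteq> V \<times> V" "sym E" "irrefl E"
  shows "\<exists>D. D \<union> D\<inverse> = E \<and> D \<inter> D\<inverse> = {}"
proof -
  have "degenerate E V (card V)"
    using assms(1) unfolding degenerate_def
    by (auto intro!: card_mono)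
  from degenerate_imp_orientation[OF assms(1) this assms(3,4)] show ?thesis
    using assms(2) by (metis inf.absorb1)
qed

text \<open>
  The labelling of the edges inside a vertex set \<open>W\<close> is determined by the codes of the vertices of \<open>W\<close>, so
  \<open>2 ^ e(W) \<le> N ^ card W\<close>.
\<close>

lemma edge_encodable_imp_degenerate:
  assumes "finite V" "E \<subseteq> V \<times> V" "sym E" "irrefl E" "edge_encodable V E N"
  shows "degenerate E V (2 * N)"
  unfolding degenerate_def
proof (intro allI impI)
  fix W assume W: "W \<subseteq> V" "W \<noteq> {}"
  then have fin: "finite W" using assms(1) finite_subset by blast
  obtain dec :: "nat \<Rightarrow> nat \<Rightarrow> bool"
    where "\<forall>S\<subseteq>E. sym S \<longrightarrow> (\<exists>f. f ` V \<subseteq> {..<N} \<and> (\<forall>(u, v)\<in>E. (u, v) \<in> S \<longleftrightarrow> dec (f u) (f v)))"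
    using assms(5) unfolding edge_encodable_def by (elim exE)
  then have "\<forall>S. \<exists>f. S \<subseteq> E \<longrightarrow> sym S \<longrightarrow>
      f ` V \<subseteq> {..<N} \<and> (\<forall>(u, v)\<in>E. (u, v) \<in> S \<longleftrightarrow> dec (f u) (f v))"
    by simp
  from choice[OF this] obtain F where *: "\<And>S. S \<subseteq> E \<longrightarrow> sym S \<longrightarrow>
      F S ` V \<subseteq> {..<N} \<and> (\<forall>(u, v)\<in>E. (u, v) \<in> S \<longleftrightarrow> dec (F S u) (F S v))"
    by blast
  have F: "F S ` V \<subseteq> {..<N}" "(u, v) \<in> E \<Longrightarrow> (u, v) \<in> S \<longleftrightarrow> dec (F S u) (F S v)"
    if "S \<subseteq> E" "sym S" for S u v
  proof -
    show "F S ` V \<subseteq> {..<N}" using * that by simp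
    assume "(u, v) \<in> E"
    moreover have "\<forall>(u, v)\<in>E. (u, v) \<in> S \<longleftrightarrow> dec (F S u) (F S v)" using * that by simp
    ultimately show "(u, v) \<in> S \<longleftrightarrow> dec (F S u) (F S v)" by fast
  qed
  obtain D where D: "D \<union> D\<inverse> = E" "D \<inter> D\<inverse> = {}"
    using ex_orientation[OF assms(1-4)] by (elim exE conjE)
  \<comment> \<open>One arc for each edge inside \<open>W\<close>: the subsets \<open>T\<close> of
    \<open>A\<close> correspond to the labellings of these edges, with
    \<open>T \<union> T\<inverse>\<close> as symmetric form.\<close>
  define A where "A = D \<inter> W \<times> W"
  have finA: "finite A" using fin by (auto simp: A_def)
  let ?h = "\<lambda>T. restrict (F (T \<union> T\<inverse>)) W"
  have T: "T \<union> T\<inverse> \<subseteq> E" "sym (T \<union> T\<inverse>)" if "T \<subseteq> A" for T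
    using that D(1) by (auto simp: A_def sym_def)
  have "inj_on ?h (Pow A)"
  proof (rule inj_onI)
    fix T T' assume T': "T \<in> Pow A" "T' \<in> Pow A" "?h T = ?h T'"
    have "(u, v) \<in> T \<longleftrightarrow> (u, v) \<in> T'" if uv: "(u, v) \<in> A" for u v
    proof -
      have *: "(u, v) \<in> T'' \<longleftrightarrow> (u, v) \<in> T'' \<union> T''\<inverse>" if "T'' \<subseteq> A" for T''
        using that uv D(2) by (auto simp: A_def)
      have "u \<in> W" "v \<in> W" "(u, v) \<in> E" using uv D(1) by (auto simp: A_def)
      then have "F (T \<union> T\<inverse>) u = F (T' \<union> T'\<inverse>) u" "F (T \<union> T\<inverse>) v = F (T' \<union> T'\<inverse>) v"
        using T'(3) by (metis restrict_apply')+
      then show ?thesis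
        using * F(2)[OF T \<open>(u, v) \<in> E\<close>] T'(1,2) by (metis PowD)
    qed
    then show "T = T'" using T'(1,2) by auto
  qed
  moreover have "?h ` Pow A \<subseteq> W \<rightarrow>\<^sub>E {..<N}"
  proof (rule image_subsetI, unfold restrict_PiE_iff, rule ballI)
    fix T v assume "T \<in> Pow A" "v \<in> W"
    then show "F (T \<union> T\<inverse>) v \<in> {..<N}" using F(1)[OF T] W(1) by blast
  qed
  ultimately have "2 ^ card A \<le> card (W \<rightarrow>\<^sub>E {..<N})"
    using card_inj_on_le[of ?h "Pow A"] fin by (simp add: card_Pow finite_PiE finA)
  also have "\<dots> = N ^ card W" using fin by (simp add: card_PiE)
  \<comment> \<open>The crude bound \<open>N \<le> 2 ^ N\<close> avoids logarithms.\<close>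
  also have "\<dots> \<le> (2 ^ N) ^ card W" by (intro power_mono) (simp_all add: less_imp_le)
  finally have A: "card A \<le> N * card W" by (simp flip: power_mult)
  show "\<exists>v\<in>W. card {u \<in> W. (u, v) \<in> E} \<le> 2 * N"
  proof (rule ccontr)
    assume "\<not> ?thesis"
    then have "(\<Sum>v\<in>W. Suc (2 * N)) \<le> (\<Sum>v\<in>W. card {u \<in> W. (u, v) \<in> E})"
      by (intro sum_mono) (simp add: not_le Suc_le_eq)
    then have "card W * Suc (2 * N) \<le> (\<Sum>v\<in>W. card {u \<in> W. (u, v) \<in> E})"
      by simp
    also have "\<dots> = card (SIGMA v:W. {u \<in> W. (u, v) \<in> E})"
      using fin by (simp add: card_SigmaI)
    \<comment> \<open>The degree sum counts each edge inside \<open>W\<close> from both ends, which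
      is too little if all degrees exceed \<open>2 * N\<close>.\<close>
    also have "(SIGMA v:W. {u \<in> W. (u, v) \<in> E}) = A \<union> A\<inverse>"
      using D(1) by (auto simp: A_def)
    also have "card (A \<union> A\<inverse>) \<le> 2 * card A"
      using card_Un_le[of A "A\<inverse>"] by simp
    also have "2 * card A \<le> card W * (2 * N)" using A by (simp add: mult.commute)
    finally show False using W(2) fin by simp
  qed
qed

section \<open>Oriented colourings and encodings\<close>

text \<open>A proper colouring \<open>c\<close> compares the two ends of every edge, and a code
  tells whether \<open>D\<close> agrees with the comparison; together they determine the direction.
  Asymmetry of the image of \<open>D\<close> includes properness, since a monochromatic arc would
  give a loop.\<close>

lemma edge_encodable_imp_oriented_colouring:
  assumes "finite V" "E \<subseteq> V \<times> V" "sym E" "irrefl E" "edge_encodable V E N"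
    and D: "D \<union> D\<inverse> = E" "D \<inter> D\<inverse> = {}"
  shows "\<exists>\<psi>. \<psi> ` V \<subseteq> {..2 * N} \<times> {..<N} \<and>
    map_prod \<psi> \<psi> ` D \<inter> (map_prod \<psi> \<psi> ` D)\<inverse> = {}"
proof -
  obtain c :: "'a \<Rightarrow> nat"
    where c: "c ` V \<subseteq> {..2 * N}" "\<forall>u\<in>V. \<forall>v\<in>V. (u, v) \<in> E \<longrightarrow> c u \<noteq> c v"
    using degenerate_imp_proper_colouring[OF assms(1) edge_encodable_imp_degenerate[OF assms(1-5)] assms(3,4)]
    by (elim exE conjE)
  have c': "c u \<noteq> c v" if "(u, v) \<in> E" for u v
    using c(2) assms(2) that by auto
  \<comment> \<open>Both sides of the equivalence flip when an edge is read from its other end,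
    which makes \<open>S\<close> symmetric.\<close>
  define S where "S = {(u, v) \<in> E. (u, v) \<in> D \<longleftrightarrow> c u < c v}"
  have "S \<subseteq> E" "sym S"
    using c' D by (auto simp: S_def sym_def)
  moreover obtain dec :: "nat \<Rightarrow> nat \<Rightarrow> bool"
    where "\<forall>S\<subseteq>E. sym S \<longrightarrow> (\<exists>f. f ` V \<subseteq> {..<N} \<and> (\<forall>(u, v)\<in>E. (u, v) \<in> S \<longleftrightarrow> dec (f u) (f v)))"
    using assms(5) unfolding edge_encodable_def by (elim exE)
  ultimately obtain f
    where f: "f ` V \<subseteq> {..<N}" "\<forall>(u, v)\<in>E. (u, v) \<in> S \<longleftrightarrow> dec (f u) (f v)"
    by (elim allE[of _ S] impE exE conjE)
  have *: "(u, v) \<in> D \<longleftrightarrow> (c u < c v \<longleftrightarrow> dec (f u) (f v))" if "(u, v) \<in> E" for u v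
    using f(2) that by (auto simp: S_def)
  let ?\<psi> = "\<lambda>v. (c v, f v)"
  have "False" if "(u, v) \<in> D" "(u', v') \<in> D" "?\<psi> u = ?\<psi> v'" "?\<psi> v = ?\<psi> u'" for u v u' v'
  proof -
    have "(v', u') \<in> D \<longleftrightarrow> (u, v) \<in> D"
      using *[of u v] *[of v' u'] that D(1) by auto
    then show False using that D(2) by blast
  qed
  then have "map_prod ?\<psi> ?\<psi> ` D \<inter> (map_prod ?\<psi> ?\<psi> ` D)\<inverse> = {}" by fastforce
  moreover have "?\<psi> ` V \<subseteq> {..2 * N} \<times> {..<N}" using c(1) f(1) by auto
  ultimately show ?thesis by blast
qed

text \<open>The decoder is fixed, so besides the colour a code carries the whole image relation
  \<open>R\<close> on the colours; this gives \<open>k * 2 ^ (k * k)\<close> codes per orientation.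
  A labelling is the agreement of two orientations, which squares the number.\<close>

lemma oriented_colourings_imp_edge_encodable:
  assumes "finite V" "E \<subseteq> V \<times> V" "sym E" "irrefl E"
    and col: "\<And>D. D \<union> D\<inverse> = E \<Longrightarrow> D \<inter> D\<inverse> = {} \<Longrightarrow>
      \<exists>\<psi> :: 'a \<Rightarrow> nat. \<psi> ` V \<subseteq> {1..k} \<and> map_prod \<psi> \<psi> ` D \<inter> (map_prod \<psi> \<psi> ` D)\<inverse> = {}"
  shows "edge_encodable V E ((k * 2 ^ (k * k))\<^sup>2)"
proof -
  define Q where "Q = {1..k} \<times> Pow ({1..k} \<times> {1..k})"
  define dec :: "(nat \<times> nat rel) \<times> (nat \<times> nat rel) \<Rightarrow> (nat \<times> nat rel) \<times> (nat \<times> nat rel) \<Rightarrow> bool"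
    where "dec = (\<lambda>p q. (fst (fst p), fst (fst q)) \<in> snd (fst p) \<longleftrightarrow> (fst (snd p), fst (snd q)) \<in> snd (snd p))"
  have col': "\<exists>f. f ` V \<subseteq> Q \<and> (\<forall>(u, v)\<in>E. (u, v) \<in> D \<longleftrightarrow> (fst (f u), fst (f v)) \<in> snd (f u))"
    if D: "D \<union> D\<inverse> = E" "D \<inter> D\<inverse> = {}" for D
  proof -
    obtain \<psi> :: "'a \<Rightarrow> nat" where \<psi>: "\<psi> ` V \<subseteq> {1..k}" "map_prod \<psi> \<psi> ` D \<inter> (map_prod \<psi> \<psi> ` D)\<inverse> = {}"
      using col[OF D] by blast
    define R where "R = map_prod \<psi> \<psi> ` D"
    have im: "(\<psi> u, \<psi> v) \<in> R" if "(u, v) \<in> D" for u v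
      unfolding R_def using that by (rule map_prod_imageI)
    have asym: "(a, b) \<in> R \<Longrightarrow> (b, a) \<notin> R" for a b
      using \<psi>(2) by (fold R_def) blast
    have "(u, v) \<in> D \<longleftrightarrow> (\<psi> u, \<psi> v) \<in> R" if "(u, v) \<in> E" for u v
    proof -
      have "(u, v) \<in> D \<or> (v, u) \<in> D" using that unfolding D(1)[symmetric] by blast
      then show ?thesis using im[of u v] im[of v u] asym[of "\<psi> u" "\<psi> v"] by argo
    qed
    moreover have "R \<subseteq> {1..k} \<times> {1..k}"
    proof -
      have "\<psi> v \<in> {1..k}" if "v \<in> V" for v using \<psi>(1) that by blast
      moreover have "u \<in> V" "v \<in> V" if "(u, v) \<in> D" for u v
        using that assms(2) unfolding D(1)[symmetric] by auto
      ultimately show ?thesis unfolding R_def by (intro subsetI) (elim imageE, auto)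
    qed
    ultimately show ?thesis
      using \<psi>(1) by (intro exI[of _ "\<lambda>v. (\<psi> v, R)"]) (auto simp: Q_def)
  qed
  obtain D0 where D0: "D0 \<union> D0\<inverse> = E" "D0 \<inter> D0\<inverse> = {}"
    using ex_orientation[OF assms(1-4)] by (elim exE conjE)
  obtain f0 where f0: "f0 ` V \<subseteq> Q" "\<forall>(u, v)\<in>E. (u, v) \<in> D0 \<longleftrightarrow> (fst (f0 u), fst (f0 v)) \<in> snd (f0 u)"
    using col'[OF D0] by blast
  show ?thesis
  proof (rule edge_encodableI[of "Q \<times> Q" _ _ _ dec])
    show "finite (Q \<times> Q)" by (simp add: Q_def)
    show "card (Q \<times> Q) \<le> (k * 2 ^ (k * k))\<^sup>2"
      by (simp add: Q_def card_cartesian_product card_Pow power2_eq_square)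
    show "E \<subseteq> V \<times> V" by fact
    fix S assume S: "S \<subseteq> E" "sym S"
    \<comment> \<open>\<open>D\<close> keeps the arcs of the reference orientation \<open>D0\<close>
      on \<open>S\<close> and reverses the others.\<close>
    define D where "D = {(u, v) \<in> E. (u, v) \<in> D0 \<longleftrightarrow> (u, v) \<in> S}"
    have "D \<union> D\<inverse> = E" "D \<inter> D\<inverse> = {}"
      using D0 S by (auto simp: D_def sym_def)
    from col'[OF this] obtain f
      where f: "f ` V \<subseteq> Q" "\<forall>(u, v)\<in>E. (u, v) \<in> D \<longleftrightarrow> (fst (f u), fst (f v)) \<in> snd (f u)"
      by blast
    have "(u, v) \<in> S \<longleftrightarrow> dec (f0 u, f u) (f0 v, f v)" if "(u, v) \<in> E" for u v
    proof -
      have "(u, v) \<in> S \<longleftrightarrow> ((u, v) \<in> D0 \<longleftrightarrow> (u, v) \<in> D)" using that by (auto simp: D_def)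
      also have "\<dots> \<longleftrightarrow> dec (f0 u, f u) (f0 v, f v)"
        using that f0(2) f(2) by (auto simp: dec_def split_beta)
      finally show ?thesis .
    qed
    moreover have "(\<lambda>v. (f0 v, f v)) ` V \<subseteq> Q \<times> Q" using f0(1) f(1) by auto
    ultimately show "\<exists>g. g ` V \<subseteq> Q \<times> Q \<and> (\<forall>(u, v)\<in>E. (u, v) \<in> S \<longleftrightarrow> dec (g u) (g v))"
      by (intro exI[of _ "\<lambda>v. (f0 v, f v)"]) auto
  qed
qed

section \<open>Star colourings from encodings\<close>

text \<open>For symmetric \<open>E\<close> and distinct colours, the edges between the two classes
  then form stars centred in class \<open>a\<close>.\<close>

definition unique_neighbours :: "'a rel \<Rightarrow> ('a \<Rightarrow> 'c) \<Rightarrow> 'c \<Rightarrow> 'c \<Rightarrow> bool" where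
  "unique_neighbours E \<psi> a b \<longleftrightarrow>
     (\<forall>u u' v. (u, v) \<in> E \<longrightarrow> (u', v) \<in> E \<longrightarrow> \<psi> u = a \<longrightarrow> \<psi> u' = a \<longrightarrow> \<psi> v = b \<longrightarrow> u = u')"

text \<open>A local form of star colouring, free of components and distances, with colours of any
  type.\<close>

definition star_map :: "'a rel \<Rightarrow> ('a \<Rightarrow> 'c) \<Rightarrow> bool" where
  "star_map E \<psi> \<longleftrightarrow> (\<forall>(u, v)\<in>E. \<psi> u \<noteq> \<psi> v) \<and>
     (\<forall>a b. unique_neighbours E \<psi> a b \<or> unique_neighbours E \<psi> b a)"

text \<open>
  Orient the edges with indegree at most \<open>2 * N\<close>, number the arcs entering each vertex, and let the
  colour of a vertex record an oriented colouring together with the codes of the classes of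
  equally numbered edges. All edges between two colour classes then go in the same direction and carry
  the same number, so every vertex of the class they enter has at most one neighbour in the other.
\<close>

lemma edge_encodable_imp_star_map:
  assumes "finite V" "E \<subseteq> V \<times> V" "sym E" "irrefl E" "edge_encodable V E N"
  shows "\<exists>\<psi> :: 'a \<Rightarrow> (nat \<times> nat) \<times> nat list.
    card (\<psi> ` V) \<le> (2 * N + 1) * N * N ^ (2 * N) \<and> star_map E \<psi>"
proof -
  let ?d = "2 * N"
  obtain D where D: "D \<union> D\<inverse> = E" "D \<inter> D\<inverse> = {}" and deg: "\<forall>v. card {u. (u, v) \<in> D} \<le> ?d"
    using degenerate_imp_orientation[OF assms(1) edge_encodable_imp_degenerate[OF assms(1-5)] assms(3,4)]
      Int_absorb2[OF assms(2)] by (elim exE conjE) simp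
  have DE: "(u, v) \<in> E \<longleftrightarrow> (u, v) \<in> D \<or> (v, u) \<in> D" for u v
    unfolding D(1)[symmetric] by simp
  have asym: "(u, v) \<in> D \<Longrightarrow> (v, u) \<notin> D" for u v
    using D(2) by blast
  obtain \<psi>0 where \<psi>0: "\<psi>0 ` V \<subseteq> {..?d} \<times> {..<N}"
    and orient: "map_prod \<psi>0 \<psi>0 ` D \<inter> (map_prod \<psi>0 \<psi>0 ` D)\<inverse> = {}"
    using edge_encodable_imp_oriented_colouring[OF assms D] by (elim exE conjE)
  have no_rev: False if "(u, v) \<in> D" "(x, y) \<in> D" "\<psi>0 u = \<psi>0 y" "\<psi>0 v = \<psi>0 x" for u v x y
  proof -
    have "(\<psi>0 v, \<psi>0 u) \<in> map_prod \<psi>0 \<psi>0 ` D"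
      using map_prod_imageI[OF that(2), of \<psi>0 \<psi>0] that(3,4) by (simp only:)
    then have "(\<psi>0 u, \<psi>0 v) \<in> map_prod \<psi>0 \<psi>0 ` D \<inter> (map_prod \<psi>0 \<psi>0 ` D)\<inverse>"
      by (intro IntI converseI map_prod_imageI[OF that(1)])
    then show False unfolding orient by (rule emptyE)
  qed
  have "\<exists>g. g ` {u. (u, v) \<in> D} \<subseteq> {..<?d} \<and> inj_on g {u. (u, v) \<in> D}" for v
  proof (rule card_le_inj)
    have "{u. (u, v) \<in> D} \<subseteq> V" using DE assms(2) by auto
    then show "finite {u. (u, v) \<in> D}" using assms(1) finite_subset by blast
  qed (use deg in simp_all)
  then have "\<forall>v. \<exists>g. g ` {u. (u, v) \<in> D} \<subseteq> {..<?d} \<and> inj_on g {u. (u, v) \<in> D}" by blast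
  from choice[OF this] obtain g :: "'a \<Rightarrow> 'a \<Rightarrow> nat"
    where g: "\<And>v. g v ` {u. (u, v) \<in> D} \<subseteq> {..<?d}" "\<And>v. inj_on (g v) {u. (u, v) \<in> D}"
    by fast
  \<comment> \<open>Both directions of an edge are included, since encodings are available for
    symmetric labellings only.\<close>
  define S where "S i = {(u, v). (u, v) \<in> D \<and> g v u = i \<or> (v, u) \<in> D \<and> g u v = i}" for i
  have S: "S i \<subseteq> E" "sym (S i)" for i
    using DE by (auto simp: S_def sym_def)
  obtain dec :: "nat \<Rightarrow> nat \<Rightarrow> bool"
    where dec: "\<forall>S\<subseteq>E. sym S \<longrightarrow> (\<exists>f. f ` V \<subseteq> {..<N} \<and> (\<forall>(u, v)\<in>E. (u, v) \<in> S \<longleftrightarrow> dec (f u) (f v)))"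
    using assms(5) unfolding edge_encodable_def by (elim exE)
  have "\<forall>i. \<exists>f. f ` V \<subseteq> {..<N} \<and> (\<forall>(u, v)\<in>E. (u, v) \<in> S i \<longleftrightarrow> dec (f u) (f v))"
    using dec S by simp
  from choice[OF this] obtain F
    where F: "\<And>i. F i ` V \<subseteq> {..<N}" "\<And>i. \<forall>(u, v)\<in>E. (u, v) \<in> S i \<longleftrightarrow> dec (F i u) (F i v)"
    by fast
  define \<psi> where "\<psi> v = (\<psi>0 v, map (\<lambda>i. F i v) [0..<?d])" for v
  have \<psi>D: "\<psi>0 u = \<psi>0 v" "i < ?d \<Longrightarrow> F i u = F i v" if "\<psi> u = \<psi> v" for u v i
    using that by (auto simp: \<psi>_def)
  have uniq: "unique_neighbours E \<psi> a b"
    if fwd: "\<And>u v. (u, v) \<in> E \<Longrightarrow> \<psi> u = a \<Longrightarrow> \<psi> v = b \<Longrightarrow> (u, v) \<in> D" for a b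
    unfolding unique_neighbours_def
  proof (intro allI impI)
    fix u u' v
    assume uv: "(u, v) \<in> E" "(u', v) \<in> E" "\<psi> u = a" "\<psi> u' = a" "\<psi> v = b"
    then have D': "(u, v) \<in> D" "(u', v) \<in> D" using fwd by auto
    \<comment> \<open>With \<open>i\<close> the number of the arc \<open>(u, v)\<close>, equal codes
      of \<open>u\<close> and \<open>u'\<close> put \<open>(u', v)\<close> into \<open>S i\<close>
      as well, and distinct arcs entering \<open>v\<close> never share a number.\<close>
    define i where "i = g v u"
    have "i < ?d" using g(1)[of v] D'(1) by (auto simp: i_def)
    then have "F i u = F i u'" using \<psi>D(2)[of u u'] uv by simp
    moreover have "(u, v) \<in> S i" using D'(1) by (simp add: S_def i_def)
    ultimately have "(u', v) \<in> S i"
      using bspec[OF F(2) uv(1), of i] bspec[OF F(2) uv(2), of i] by simp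
    then have "g v u' = g v u" using asym[OF D'(2)] by (simp add: S_def i_def)
    then show "u = u'" using inj_onD[OF g(2)[of v]] D' by simp
  qed
  have "unique_neighbours E \<psi> a b \<or> unique_neighbours E \<psi> b a" for a b
  \<comment> \<open>As \<open>\<psi>0\<close> is an oriented colouring, a single arc from class
    \<open>a\<close> to class \<open>b\<close> forces the direction of all edges between them;
    without one, all run from \<open>b\<close> to \<open>a\<close>.\<close>
  proof (cases "\<exists>x y. (x, y) \<in> D \<and> \<psi> x = a \<and> \<psi> y = b")
    case True
    then obtain x y where xy: "(x, y) \<in> D" "\<psi> x = a" "\<psi> y = b" by blast
    have "unique_neighbours E \<psi> a b"
    proof (rule uniq)
      fix u v assume uv: "(u, v) \<in> E" "\<psi> u = a" "\<psi> v = b"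
      then have "\<psi>0 u = \<psi>0 x" "\<psi>0 v = \<psi>0 y" using xy \<psi>D(1) by auto
      then show "(u, v) \<in> D" using no_rev[of v u x y] xy(1) uv(1) DE by auto
    qed
    then show ?thesis ..
  next
    case False
    have "unique_neighbours E \<psi> b a"
    proof (rule uniq)
      fix u v assume "(u, v) \<in> E" "\<psi> u = b" "\<psi> v = a"
      then show "(u, v) \<in> D" using False DE by blast
    qed
    then show ?thesis ..
  qed
  moreover have "\<psi> u \<noteq> \<psi> v" if "(u, v) \<in> E" for u v
    using that no_rev[of u v u v] no_rev[of v u v u] \<psi>D(1)[of u v] DE by auto
  ultimately have "star_map E \<psi>" by (auto simp: star_map_def)
  moreover have "card (\<psi> ` V) \<le> (2 * N + 1) * N * N ^ (2 * N)"
  proof -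
    let ?Q = "({..?d} \<times> {..<N}) \<times> {xs. set xs \<subseteq> {..<N} \<and> length xs = ?d}"
    have "F i v < N" if "v \<in> V" for i v using F(1)[of i] that by blast
    then have sub: "\<psi> ` V \<subseteq> ?Q" using \<psi>0 by (auto simp: \<psi>_def)
    have fin: "finite ?Q" by (intro finite_cartesian_product finite_lists_length_eq) auto
    have "card ?Q = (2 * N + 1) * N * N ^ (2 * N)"
      by (simp add: card_cartesian_product card_lists_length_eq)
    then show ?thesis using card_mono[OF fin sub] by (simp only:)
  qed
  ultimately show ?thesis by (intro exI conjI)
qed

lemma pair_graph_facts:
  assumes "pair_graph G"
  shows "finite (pverts G)" "parcs G \<subseteq> pverts G \<times> pverts G" "sym (parcs G)" "irrefl (parcs G)"
proof -
  interpret pair_graph G by fact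
  show "finite (pverts G)" by (rule pair_finite_verts)
  show "parcs G \<subseteq> pverts G \<times> pverts G" by (auto dest: in_arcsD1 in_arcsD2)
  show "sym (parcs G)" using arcs_symmetric by (auto simp: sym_def)
  show "irrefl (parcs G)" by (auto simp: irrefl_def dest: no_loops')
qed

lemma (in wf_digraph) awalk_cost_1: "awalk_cost (\<lambda>_. 1) p = real (length p)"
  by (induction p) simp_all

section \<open>Star forests and forests\<close>

text \<open>Exactly one of the inner vertices \<open>y\<close>, \<open>z\<close> has colour
  \<open>j\<close>; both its neighbours on the walk have colour \<open>i\<close>, so they
  coincide.\<close>

lemma bicoloured_walk_backtracks:
  assumes "sym E" "\<forall>(u, v)\<in>E. \<phi> u \<noteq> \<phi> v" "unique_neighbours E \<phi> i j"
    and "\<phi> ` {x, y, z, w} \<subseteq> {i, j}" and "(x, y) \<in> E" "(y, z) \<in> E" "(z, w) \<in> E"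
  shows "x = z \<or> y = w"
proof -
  have *: "(y, x) \<in> E" "(z, y) \<in> E" "(w, z) \<in> E"
    using assms(1,5-7) by (auto dest: symD)
  have ne: "\<phi> x \<noteq> \<phi> y" "\<phi> y \<noteq> \<phi> z" "\<phi> z \<noteq> \<phi> w"
    using assms(2,5-7) by auto
  show ?thesis
  proof (cases "\<phi> y = j")
    case True
    with ne assms(4) have "\<phi> x = i" "\<phi> z = i" by auto
    then show ?thesis
      using assms(3,5) *(2) True unfolding unique_neighbours_def by blast
  next
    case False
    with ne assms(4) have "\<phi> y = i" "\<phi> z = j" "\<phi> w = i" by auto
    then show ?thesis
      using assms(3,6) *(3) unfolding unique_neighbours_def by blast
  qed
qed

text \<open>Three consecutive arcs always backtrack. Hence no cycle has length at least three, and a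
  walk with more than two arcs can be shortened, which bounds the distances in a component by
  2.\<close>

lemma induced_star_forest:
  assumes "pair_graph G" and proper: "\<forall>(u, v)\<in>parcs G. \<phi> u \<noteq> \<phi> v"
    and "unique_neighbours (parcs G) \<phi> i j" and W: "\<phi> ` W \<subseteq> {i, j}"
  shows "star_forest (with_proj G \<restriction> W)"
proof -
  interpret G: pair_graph G by fact
  let ?H = "with_proj G \<restriction> W"
  have backtrack: "fst e1 = snd e2 \<or> snd e1 = snd e3"
    if "{e1, e2, e3} \<subseteq> arcs ?H" "fst e2 = snd e1" "fst e3 = snd e2" for e1 e2 e3
    using that W
    by (intro bicoloured_walk_backtracks[OF pair_graph_facts(3)[OF assms(1)] proper assms(3)])
       (auto, (metis prod.collapse)+)
  have "undirected_forest ?H"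
    unfolding undirected_forest_def
  proof
    assume "\<exists>p. pre_digraph.cycle ?H p \<and> length p \<ge> 3"
    then obtain p u where p: "pre_digraph.awalk ?H u p u"
      "distinct (tl (pre_digraph.awalk_verts ?H u p))" "length p \<ge> 3"
      unfolding pre_digraph.cycle_def by blast
    interpret H: wf_digraph ?H by (rule G.wellformed_induce_subgraph)
    obtain e1 e2 e3 q where q: "p = e1 # e2 # e3 # q"
      using p(3) by (metis Suc_le_length_iff numeral_3_eq_3)
    have w: "fst e1 = u" "fst e2 = snd e1" "fst e3 = snd e2" "H.cas (snd e3) q u"
      "{e1, e2, e3} \<subseteq> arcs ?H"
      using p(1) by (auto simp: H.awalk_def q)
    have d: "distinct (fst e2 # fst e3 # H.awalk_verts (snd e3) q)"
      using p(2) by (simp add: q)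
    \<comment> \<open>The vertex \<open>u\<close> and the head of \<open>e3\<close> are the two ends
      of the rest \<open>q\<close> of the cycle, so a backtrack would repeat one of them in the
      distinct list \<open>d\<close>.\<close>
    have "u \<in> set (H.awalk_verts (snd e3) q)"
      using H.awlast_if_cas[OF w(4)] H.awalk_verts_non_Nil by (metis last_in_set)
    moreover have "snd e3 \<in> set (H.awalk_verts (snd e3) q)"
      using H.awhd_if_cas[OF w(4)] H.awalk_verts_non_Nil by (metis hd_in_set)
    ultimately show False using d backtrack[OF w(5,2,3)] w(1-3) by auto
  qed
  moreover have "wf_digraph.diameter H \<le> 2" if H: "H \<in> pre_digraph.sccs ?H" for H
  proof -
    from H have sub: "subgraph H ?H" and sc: "strongly_connected H"
      by (auto simp: pre_digraph.sccs_def induced_subgraph_def)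
    then interpret H: wf_digraph H by (simp add: subgraph_def)
    have th: "tail H = fst" "head H = snd" "arcs H \<subseteq> arcs ?H"
      using sub by (auto simp: subgraph_def compatible_def)
    have short: "\<exists>q. H.awalk u q v \<and> length q \<le> 2" if "H.awalk u p v" for u p v
      using that
    proof (induction p arbitrary: u rule: length_induct)
      case (1 p)
      show ?case
      proof (cases "length p \<le> 2")
        case False
        then obtain e1 e2 e3 q where q: "p = e1 # e2 # e3 # q"
          by (metis Suc_le_length_iff not_less_eq_eq numeral_2_eq_2)
        have w: "fst e1 = u" "fst e2 = snd e1" "fst e3 = snd e2" "{e1, e2, e3} \<subseteq> arcs H"
          using "1.prems" by (auto simp: H.awalk_def q th)
        then have "fst e1 = snd e2 \<or> snd e1 = snd e3"
          using th(3) by (intro backtrack) auto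
        then have "H.awalk u (e3 # q) v \<or> H.awalk u (e1 # q) v"
          using "1.prems" by (auto simp: H.awalk_def q th)
        then show ?thesis
        proof
          assume "H.awalk u (e3 # q) v"
          then show ?thesis using "1.IH"[rule_format, of "e3 # q" u] by (simp add: q)
        next
          assume "H.awalk u (e1 # q) v"
          then show ?thesis using "1.IH"[rule_format, of "e1 # q" u] by (simp add: q)
        qed
      qed (use "1.prems" in blast)
    qed
    show ?thesis unfolding H.diameter_def
    proof (intro SUP_least)
      fix u v assume "u \<in> verts H" "v \<in> verts H"
      then have "u \<rightarrow>\<^sup>*\<^bsub>H\<^esub> v" using sc by (auto simp: strongly_connected_def)
      then obtain q where q: "H.awalk u q v" "length q \<le> 2"
        using short unfolding H.reachable_awalk by blast
      have "H.\<mu> (\<lambda>_. 1) u v \<le> ereal (real (length q))"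
        using H.min_cost_le_walk_cost[OF q(1), of "\<lambda>_. 1"] by (simp add: H.awalk_cost_1)
      also have "\<dots> \<le> 2" using q(2) by simp
      finally show "H.\<mu> (\<lambda>_. 1) u v \<le> 2" .
    qed
  qed
  ultimately show ?thesis unfolding star_forest_def by blast
qed

section \<open>Existence of star and acyclic colourings\<close>

text \<open>Colours may be tuples or lists until the end: only the number of colours used on
  \<open>V\<close> counts, and these are renumbered injectively.\<close>

lemma ex_recolouring:
  assumes "finite V" "card (\<psi> ` V) \<le> k"
  shows "\<exists>g. inj_on g (\<psi> ` V) \<and> (g \<circ> \<psi>) ` V \<subseteq> {1..k :: nat}"
proof -
  have "\<exists>g. g ` \<psi> ` V \<subseteq> {1..k} \<and> inj_on g (\<psi> ` V)"
    using assms by (intro card_le_inj) auto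
  then show ?thesis by (auto simp: image_comp)
qed

lemma star_map_imp_star_colouring:
  assumes "pair_graph G" "star_map (parcs G) \<psi>" "card (\<psi> ` pverts G) \<le> k"
  shows "\<exists>\<phi>. star_colouring G k \<phi>"
proof -
  note G = pair_graph_facts[OF assms(1)]
  obtain g where g: "inj_on g (\<psi> ` pverts G)" "(g \<circ> \<psi>) ` pverts G \<subseteq> {1..k}"
    using ex_recolouring[OF G(1) assms(3)] by (elim exE conjE)
  define \<phi> where "\<phi> = g \<circ> \<psi>"
  have \<phi>: "\<phi> u = \<phi> v \<longleftrightarrow> \<psi> u = \<psi> v" if "u \<in> pverts G" "v \<in> pverts G" for u v
    using inj_on_eq_iff[OF g(1)] that by (simp add: \<phi>_def)
  have V: "u \<in> pverts G" "v \<in> pverts G" if "(u, v) \<in> parcs G" for u v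
    using G(2) that by auto
  have proper: "\<forall>(u, v)\<in>parcs G. \<phi> u \<noteq> \<phi> v"
    using assms(2) V \<phi> by (auto simp: star_map_def)
  have un: "unique_neighbours (parcs G) \<phi> (\<phi> x) (\<phi> y)"
    if "unique_neighbours (parcs G) \<psi> (\<psi> x) (\<psi> y)" "x \<in> pverts G" "y \<in> pverts G" for x y
    unfolding unique_neighbours_def
  proof (intro allI impI)
    fix u u' v assume uv: "(u, v) \<in> parcs G" "(u', v) \<in> parcs G" "\<phi> u = \<phi> x" "\<phi> u' = \<phi> x" "\<phi> v = \<phi> y"
    then have "\<psi> u = \<psi> x" "\<psi> u' = \<psi> x" "\<psi> v = \<psi> y"
      using \<phi> V[OF uv(1)] V[OF uv(2)] that(2,3) by auto
    then show "u = u'" using that(1) uv(1,2) unfolding unique_neighbours_def by blast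
  qed
  have "star_forest (with_proj G \<restriction> (colour_class G \<phi> i \<union> colour_class G \<phi> j))" for i j
  proof -
    have "unique_neighbours (parcs G) \<phi> i j \<or> unique_neighbours (parcs G) \<phi> j i"
    proof (cases "\<exists>x\<in>pverts G. \<exists>y\<in>pverts G. \<phi> x = i \<and> \<phi> y = j")
      case True
      then obtain x y where "x \<in> pverts G" "y \<in> pverts G" "\<phi> x = i" "\<phi> y = j" by blast
      then show ?thesis
        using un[of x y] un[of y x] assms(2) unfolding star_map_def by blast
    next
      \<comment> \<open>One of the two classes is empty, and the condition is vacuous.\<close>
      case False
      then show ?thesis using V unfolding unique_neighbours_def by blast
    qed
    moreover have "\<phi> ` (colour_class G \<phi> i \<union> colour_class G \<phi> j) \<subseteq> {i, j}"
      "\<phi> ` (colour_class G \<phi> i \<union> colour_class G \<phi> j) \<subseteq> {j, i}"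
      by (auto simp: colour_class_def)
    ultimately show ?thesis
      using induced_star_forest[OF assms(1) proper] by blast
  qed
  then have "star_colouring G k \<phi>"
    using proper g(2) by (auto simp: star_colouring_def proper_colouring_def \<phi>_def)
  then show ?thesis by blast
qed

text \<open>Giving every vertex its own colour ensures that the \<open>LEAST\<close> in the star
  chromatic number, and likewise in the acyclic one, is attained.\<close>

lemma ex_star_colouring:
  assumes "pair_graph G"
  shows "\<exists>k \<phi>. star_colouring G k \<phi>"
proof -
  have "star_map (parcs G) (\<lambda>v. v)"
    using pair_graph_facts(4)[OF assms]
    by (auto simp: star_map_def unique_neighbours_def irrefl_def)
  from star_map_imp_star_colouring[OF assms this order_refl] show ?thesis by blast
qed

lemma star_colouring_imp_acyclic_colouring: "star_colouring G k \<phi> \<Longrightarrow> acyclic_colouring G k \<phi>"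
  by (simp add: star_colouring_def acyclic_colouring_def star_forest_def)

lemma star_colouring_star_chromatic_number:
  assumes "pair_graph G"
  shows "\<exists>\<phi>. star_colouring G (star_chromatic_number G) \<phi>"
  unfolding star_chromatic_number_def using ex_star_colouring[OF assms] by (rule LeastI_ex)

lemma acyclic_colouring_acyclic_chromatic_number:
  assumes "pair_graph G"
  shows "\<exists>\<phi>. acyclic_colouring G (acyclic_chromatic_number G) \<phi>"
  unfolding acyclic_chromatic_number_def
  using ex_star_colouring[OF assms] star_colouring_imp_acyclic_colouring
  by (intro LeastI_ex[of "\<lambda>k. \<exists>\<phi>. acyclic_colouring G k \<phi>"]) blast

lemma acyclic_chromatic_number_le_star:
  assumes "pair_graph G"
  shows "acyclic_chromatic_number G \<le> star_chromatic_number G"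
  unfolding acyclic_chromatic_number_def
  using star_colouring_star_chromatic_number[OF assms] star_colouring_imp_acyclic_colouring
  by (intro Least_le) blast

section \<open>Cycles and degeneracy\<close>

text \<open>Cycles are constructed below as vertex lists; this turns such lists into walks of the
  induced subgraph.\<close>

lemma awalk_vwalk_arcs:
  assumes "xs \<noteq> []" "set xs \<subseteq> W" "W \<subseteq> pverts G" "successively (\<lambda>u v. (u, v) \<in> parcs G) xs"
  shows "pre_digraph.awalk (with_proj G \<restriction> W) (hd xs) (vwalk_arcs xs) (last xs)"
    and "pre_digraph.awalk_verts (with_proj G \<restriction> W) (hd xs) (vwalk_arcs xs) = xs"
  using assms
  by (induction xs rule: induct_list012)
     (auto simp: pre_digraph.awalk_def pre_digraph.cas.simps pre_digraph.awalk_verts.simps)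

text \<open>A set \<open>U\<close> of minimum degree at least two contains a cycle: all neighbours
  of the first vertex of a longest path lie on the path, and one other than the second vertex closes
  a cycle.\<close>

lemma undirected_forest_imp_degenerate:
  assumes "pair_graph G" "W \<subseteq> pverts G" and forest: "undirected_forest (with_proj G \<restriction> W)"
  shows "degenerate (parcs G) W 1"
  unfolding degenerate_def
proof (intro allI impI, rule ccontr)
  fix U assume U: "U \<subseteq> W" "U \<noteq> {}" "\<not> (\<exists>v\<in>U. card {u \<in> U. (u, v) \<in> parcs G} \<le> 1)"
  note G = pair_graph_facts[OF assms(1)]
  have fin: "finite U" using U(1) assms(2) G(1) by (meson finite_subset)
  define P where "P xs \<longleftrightarrow> xs \<noteq> [] \<and> distinct xs \<and> set xs \<subseteq> U \<and> successively (\<lambda>u v. (u, v) \<in> parcs G) xs" for xs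
  obtain x where "x \<in> U" using U(2) by blast
  then have "P [x]" by (simp add: P_def)
  moreover have "\<forall>xs. P xs \<longrightarrow> length xs < Suc (card U)"
    using fin by (auto simp: P_def less_Suc_eq_le simp flip: distinct_card intro: card_mono)
  ultimately obtain xs where xs: "P xs" "\<forall>ys. P ys \<longrightarrow> length ys \<le> length xs"
    using ex_has_greatest_nat[of P "[x]" length "Suc (card U)"] by blast
  define v where "v = hd xs"
  have v: "v \<in> U" "xs \<noteq> []" using xs(1) by (auto simp: P_def v_def)
  then have "\<not> card {u \<in> U. (u, v) \<in> parcs G} \<le> Suc 0" using U(3) by auto
  then obtain a b where ab: "a \<in> U" "b \<in> U" "(a, v) \<in> parcs G" "(b, v) \<in> parcs G" "a \<noteq> b"
    using fin by (auto simp: card_le_Suc0_iff_eq)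
  have in_xs: "w \<in> set xs" if "w \<in> U" "(w, v) \<in> parcs G" for w
  proof (rule ccontr)
    assume "w \<notin> set xs"
    then have "P (w # xs)" using xs(1) that by (cases xs) (auto simp: P_def v_def)
    then show False using xs(2) by fastforce
  qed
  \<comment> \<open>At most one of \<open>a\<close> and \<open>b\<close> is the second vertex of the
    path; the guard covers a path with a single vertex, where \<open>xs ! 1\<close> is
    unspecified.\<close>
  obtain w where w: "w \<in> U" "(w, v) \<in> parcs G" "length xs > 1 \<Longrightarrow> w \<noteq> xs ! 1"
    using ab by metis
  obtain m where m: "m < length xs" "xs ! m = w"
    using in_xs[OF w(1,2)] by (auto simp: in_set_conv_nth)
  have "w \<noteq> v" using w(2) G(4) by (auto simp: irrefl_def)
  then have "m \<noteq> 0" using m v(2) by (metis v_def hd_conv_nth)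
  moreover have "m \<noteq> 1" using m w(3) by auto
  ultimately have "m \<ge> 2" by simp
  \<comment> \<open>The segment of the path from \<open>v\<close> to \<open>w\<close>; as
    \<open>m \<ge> 2\<close>, it has at least three vertices, and returning to \<open>v\<close>
    closes the cycle.\<close>
  define c where "c = take (Suc m) xs"
  have c: "c \<noteq> []" "hd c = v" "last c = w" "length c \<ge> 3"
    using m \<open>m \<ge> 2\<close> v(2) by (auto simp: c_def v_def take_Suc_conv_app_nth)
  have c': "distinct c" "set c \<subseteq> U"
    using xs(1) set_take_subset[of "Suc m" xs] by (auto simp: c_def P_def)
  have "successively (\<lambda>u v. (u, v) \<in> parcs G) c"
    using xs(1) append_take_drop_id[of "Suc m" xs] unfolding P_def c_def
    by (metis successively_append_iff)
  then have "successively (\<lambda>u v. (u, v) \<in> parcs G) (c @ [v])"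
    using c(1,3) w(2) by (simp add: successively_append_iff)
  moreover have "set (c @ [v]) \<subseteq> W" using c'(2) v(1) U(1) by auto
  ultimately have "pre_digraph.awalk (with_proj G \<restriction> W) v (vwalk_arcs (c @ [v])) v"
    "pre_digraph.awalk_verts (with_proj G \<restriction> W) v (vwalk_arcs (c @ [v])) = c @ [v]"
    using awalk_vwalk_arcs[of "c @ [v]" W G] assms(2) c(1,2) by simp_all
  moreover have "distinct (tl (c @ [v]))" using c(1,2) c'(1) by (cases c) auto
  moreover have "length (vwalk_arcs (c @ [v])) \<ge> 3"
    using vwalk_length_simp[of "c @ [v]"] c(4) unfolding vwalk_length_def by simp
  moreover from this have "vwalk_arcs (c @ [v]) \<noteq> []" by auto
  ultimately show False
    using forest unfolding undirected_forest_def pre_digraph.cycle_def by metis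
qed

section \<open>Oriented colourings\<close>

text \<open>An oriented colouring is a homomorphism to an oriented graph on the colours: asymmetry
  of the image excludes monochromatic arcs, which give loops, as well as opposite arcs between two
  classes.\<close>

lemma oriented_colouring_iff:
  assumes "parcs D \<subseteq> pverts D \<times> pverts D"
  shows "oriented_colouring D k \<phi> \<longleftrightarrow> \<phi> ` pverts D \<subseteq> {1..k} \<and>
    map_prod \<phi> \<phi> ` parcs D \<inter> (map_prod \<phi> \<phi> ` parcs D)\<inverse> = {}"
    (is "?L \<longleftrightarrow> ?R1 \<and> ?R2")
proof -
  have R2: "?R2 \<longleftrightarrow> (\<forall>u v u' v'. (u, v) \<in> parcs D \<longrightarrow> (u', v') \<in> parcs D \<longrightarrow> \<phi> u = \<phi> v' \<longrightarrow> \<phi> v \<noteq> \<phi> u')"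
    (is "_ \<longleftrightarrow> ?R3")
    by (fastforce simp: disjoint_iff)
  show ?thesis unfolding R2
  proof
    assume L: ?L
    then have V: "\<phi> v \<in> {1..k}" if "v \<in> pverts D" for v
      using that by (auto simp: oriented_colouring_def proper_colouring_def)
    moreover have ?R3
    proof (intro allI impI notI)
      fix u v u' v'
      assume uv: "(u, v) \<in> parcs D" "(u', v') \<in> parcs D" "\<phi> u = \<phi> v'" "\<phi> v = \<phi> u'"
      have "u \<in> pverts D" "v \<in> pverts D" "u' \<in> pverts D" "v' \<in> pverts D" using uv(1,2) assms by auto
      \<comment> \<open>For equal colours the two inclusions below would coincide and exclude
        nothing.\<close>
      moreover have "\<phi> u \<noteq> \<phi> v"
        using L uv(1) by (auto simp: oriented_colouring_def proper_colouring_def)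
      moreover have "arcs_linking D (colour_class D \<phi> (\<phi> u)) (colour_class D \<phi> (\<phi> v))
            \<subseteq> colour_class D \<phi> (\<phi> u) \<times> colour_class D \<phi> (\<phi> v) \<or>
          arcs_linking D (colour_class D \<phi> (\<phi> u)) (colour_class D \<phi> (\<phi> v))
            \<subseteq> colour_class D \<phi> (\<phi> v) \<times> colour_class D \<phi> (\<phi> u)"
        using L V \<open>u \<in> pverts D\<close> \<open>v \<in> pverts D\<close>
        by (simp add: oriented_colouring_def Let_def)
      ultimately show False
        using uv by (auto simp: arcs_linking_def colour_class_def)
    qed
    ultimately show "?R1 \<and> ?R3" by blast
  next
    assume R: "?R1 \<and> ?R3"
    then have *: False if "(u, v) \<in> parcs D" "(u', v') \<in> parcs D" "\<phi> u = \<phi> v'" "\<phi> v = \<phi> u'" for u v u' v'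
      using that by blast
    have "proper_colouring D k \<phi>"
      using R * by (fastforce simp: proper_colouring_def)
    moreover have "arcs_linking D (colour_class D \<phi> i) (colour_class D \<phi> j)
            \<subseteq> colour_class D \<phi> i \<times> colour_class D \<phi> j \<or>
          arcs_linking D (colour_class D \<phi> i) (colour_class D \<phi> j)
            \<subseteq> colour_class D \<phi> j \<times> colour_class D \<phi> i" for i j
    proof (rule ccontr)
      assume not_linked: "\<not> ?thesis"
      obtain u v where "(u, v) \<in> parcs D" "\<phi> u = i" "\<phi> v = j"
        using not_linked by (auto simp: arcs_linking_def colour_class_def)
      moreover obtain u' v' where "(u', v') \<in> parcs D" "\<phi> u' = j" "\<phi> v' = i"
        using not_linked by (auto simp: arcs_linking_def colour_class_def)
      ultimately show False using *[of u v u' v'] by simp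
    qed
    ultimately show ?L by (simp add: oriented_colouring_def Let_def)
  qed
qed

lemma orientationsD:
  assumes "D \<in> orientations G"
  shows "pverts D = pverts G" "parcs D \<union> (parcs D)\<inverse> = parcs G" "parcs D \<inter> (parcs D)\<inverse> = {}"
    "(u, v) \<in> parcs G \<longleftrightarrow> (u, v) \<in> parcs D \<or> (v, u) \<in> parcs D"
    "(u, v) \<in> parcs D \<Longrightarrow> (v, u) \<notin> parcs D"
  using assms by (auto simp: orientations_def)

text \<open>An injective renumbering of the colours keeps the image relation asymmetric.\<close>

lemma oriented_colouring_if_map:
  assumes "pair_graph G" "D \<in> orientations G"
    and "map_prod \<psi> \<psi> ` parcs D \<inter> (map_prod \<psi> \<psi> ` parcs D)\<inverse> = {}" "card (\<psi> ` pverts G) \<le> k"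
  shows "\<exists>\<phi>. oriented_colouring D k \<phi>"
proof -
  note G = pair_graph_facts[OF assms(1)] and D = orientationsD[OF assms(2)]
  obtain g where g: "inj_on g (\<psi> ` pverts G)" "(g \<circ> \<psi>) ` pverts G \<subseteq> {1..k}"
    using ex_recolouring[OF G(1) assms(4)] by (elim exE conjE)
  define R where "R = map_prod \<psi> \<psi> ` parcs D"
  have DV: "parcs D \<subseteq> pverts D \<times> pverts D" using G(2) D(1,2) by auto
  then have R: "R \<subseteq> (\<psi> ` pverts G) \<times> (\<psi> ` pverts G)" using D(1) by (auto simp: R_def)
  have "map_prod (g \<circ> \<psi>) (g \<circ> \<psi>) ` parcs D = map_prod g g ` R"
    by (simp add: R_def image_comp map_prod.comp)
  moreover have "map_prod g g ` R \<inter> (map_prod g g ` R)\<inverse> = {}"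
  proof (rule equals0I)
    fix p assume "p \<in> map_prod g g ` R \<inter> (map_prod g g ` R)\<inverse>"
    then obtain a b a' b' where ab: "(a, b) \<in> R" "(a', b') \<in> R" "g a = g b'" "g b = g a'" by auto
    then have "a = b'" "b = a'" using R inj_onD[OF g(1)] by blast+
    then show False using ab(1,2) assms(3) unfolding R_def[symmetric] by blast
  qed
  ultimately have "oriented_colouring D k (g \<circ> \<psi>)"
    using g(2) D(1) by (simp add: oriented_colouring_iff[OF DV])
  then show ?thesis by blast
qed

lemma ex_oriented_colouring:
  assumes "pair_graph G" "D \<in> orientations G"
  shows "\<exists>k \<phi>. oriented_colouring D k \<phi>"
proof -
  have "map_prod (\<lambda>v. v) (\<lambda>v. v) ` parcs D \<inter> (map_prod (\<lambda>v. v) (\<lambda>v. v) ` parcs D)\<inverse> = {}"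
    using orientationsD(3)[OF assms(2)] by (simp add: map_prod.identity[unfolded id_def])
  from oriented_colouring_if_map[OF assms this order_refl] show ?thesis by blast
qed

lemma oriented_chromatic_number_le:
  assumes "pair_graph G" "edge_encodable (pverts G) (parcs G) N"
  shows "oriented_chromatic_number G \<le> (2 * N + 1) * N"
proof -
  note G = pair_graph_facts[OF assms(1)]
  have "oriented_chromatic_number_digraph D \<le> (2 * N + 1) * N" if D: "D \<in> orientations G" for D
  proof -
    obtain \<psi> where \<psi>: "\<psi> ` pverts G \<subseteq> {..2 * N} \<times> {..<N}"
      "map_prod \<psi> \<psi> ` parcs D \<inter> (map_prod \<psi> \<psi> ` parcs D)\<inverse> = {}"
      using edge_encodable_imp_oriented_colouring[OF G assms(2) orientationsD(2,3)[OF D]]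
      by (elim exE conjE)
    have "card (\<psi> ` pverts G) \<le> (2 * N + 1) * N"
      using card_mono[OF _ \<psi>(1)] by (simp add: card_cartesian_product)
    from oriented_colouring_if_map[OF assms(1) D \<psi>(2) this] show ?thesis
      unfolding oriented_chromatic_number_digraph_def by (intro Least_le)
  qed
  then show ?thesis
    unfolding oriented_chromatic_number_def
    using finite_orientations[OF assms(1)] orientations_nonempty[OF assms(1)] by simp
qed

lemma oriented_chromatic_number_imp_edge_encodable:
  assumes "pair_graph G" "oriented_chromatic_number G \<le> k"
  shows "edge_encodable (pverts G) (parcs G) ((k * 2 ^ (k * k))\<^sup>2)"
proof (rule oriented_colourings_imp_edge_encodable)
  note G = pair_graph_facts[OF assms(1)]
  fix A assume A: "A \<union> A\<inverse> = parcs G" "A \<inter> A\<inverse> = {}"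
  define D where "D = \<lparr> pverts = pverts G, parcs = A \<rparr>"
  have D: "D \<in> orientations G" using A by (simp add: orientations_def D_def)
  have DV: "parcs D \<subseteq> pverts D \<times> pverts D" using G(2) A(1) by (auto simp: D_def)
  define m where "m = oriented_chromatic_number_digraph D"
  have "m \<le> oriented_chromatic_number G"
    unfolding oriented_chromatic_number_def m_def
    using finite_orientations[OF assms(1)] D by simp
  then have "m \<le> k" using assms(2) by simp
  have "\<exists>\<phi>. oriented_colouring D m \<phi>"
    unfolding m_def oriented_chromatic_number_digraph_def
    using ex_oriented_colouring[OF assms(1) D] by (rule LeastI_ex)
  then obtain \<phi> where \<phi>: "\<phi> ` pverts D \<subseteq> {1..m}"
    "map_prod \<phi> \<phi> ` parcs D \<inter> (map_prod \<phi> \<phi> ` parcs D)\<inverse> = {}"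
    unfolding oriented_colouring_iff[OF DV] by (elim exE conjE)
  have "{1..m} \<subseteq> {1..k}" using \<open>m \<le> k\<close> by simp
  with \<phi>(1) have "\<phi> ` pverts D \<subseteq> {1..k}" by (rule subset_trans)
  with \<phi>(2) show "\<exists>\<psi> :: 'a \<Rightarrow> nat. \<psi> ` pverts G \<subseteq> {1..k} \<and> map_prod \<psi> \<psi> ` A \<inter> (map_prod \<psi> \<psi> ` A)\<inverse> = {}"
    unfolding D_def by (intro exI[of _ \<phi>]) simp
qed (rule pair_graph_facts[OF assms(1)])+

lemma star_chromatic_number_le:
  assumes "pair_graph G" "edge_encodable (pverts G) (parcs G) N"
  shows "star_chromatic_number G \<le> (2 * N + 1) * N * N ^ (2 * N)"
proof -
  obtain \<psi> :: "'a \<Rightarrow> (nat \<times> nat) \<times> nat list"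
    where "card (\<psi> ` pverts G) \<le> (2 * N + 1) * N * N ^ (2 * N)" "star_map (parcs G) \<psi>"
    using edge_encodable_imp_star_map[OF pair_graph_facts[OF assms(1)] assms(2)] by (elim exE conjE)
  then show ?thesis
    unfolding star_chromatic_number_def
    using star_map_imp_star_colouring[OF assms(1)] by (intro Least_le)
qed

section \<open>Inversions\<close>

text \<open>Each set containing both ends reverses the arc once, so only the parity of their number
  matters, not the order of the inversions.\<close>

lemma parcs_fold_inversion:
  "(u, v) \<in> parcs (fold inversion Xs D) \<longleftrightarrow>
     (if odd (length [X\<leftarrow>Xs. u \<in> X \<and> v \<in> X]) then (v, u) \<in> parcs D else (u, v) \<in> parcs D)"
proof (induction Xs arbitrary: D)
  case (Cons X Xs)
  have "(x, y) \<in> parcs (inversion X D) \<longleftrightarrow>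
      (if x \<in> X \<and> y \<in> X then (y, x) \<in> parcs D else (x, y) \<in> parcs D)" for x y
    by (simp add: inversion_def)
  then show ?case by (simp add: Cons)
qed simp

lemma pverts_fold_inversion: "pverts (fold inversion Xs D) = pverts D"
  by (induction Xs arbitrary: D) (simp_all add: inversion_def)

lemma inversion_in_orientations:
  assumes "D \<in> orientations G"
  shows "inversion X D \<in> orientations G"
proof -
  let ?I = "parcs (inversion X D)"
  have I: "(u, v) \<in> ?I \<longleftrightarrow> (if u \<in> X \<and> v \<in> X then (v, u) \<in> parcs D else (u, v) \<in> parcs D)" for u v
    by (simp add: inversion_def)
  have "?I \<union> ?I\<inverse> = parcs G" "?I \<inter> ?I\<inverse> = {}"
    using orientationsD(4,5)[OF assms] I by (auto split: if_splits)
  moreover have "pverts (inversion X D) = pverts G"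
    using orientationsD(1)[OF assms] by (simp add: inversion_def)
  ultimately show ?thesis by (simp add: orientations_def)
qed

lemma wf_inversion_graph: "pair_graph G \<Longrightarrow> wf_digraph (with_proj (inversion_graph G))"
  using pair_graph_inversion_graph
  by (metis pair_graph.axioms(2) pair_pseudo_graph.axioms(1) pair_fin_digraph.axioms(1) wf_digraph_wp_iff)

section \<open>Walks in the inversion graph\<close>

text \<open>Inversions that fix the current orientation are not edges and are skipped, hence the
  mere upper bound on the length.\<close>

lemma fold_inversion_imp_awalk:
  assumes "pair_graph G" "D \<in> orientations G" "\<Union> (set Xs) \<subseteq> pverts G"
  shows "\<exists>p. pre_digraph.awalk (with_proj (inversion_graph G)) D p (fold inversion Xs D) \<and>
    length p \<le> length Xs"
  using assms(2,3)
proof (induction Xs arbitrary: D)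
  case Nil
  then show ?case
    by (intro exI[of _ "[]"]) (simp add: pre_digraph.awalk_def pre_digraph.cas.simps inversion_graph_def)
next
  case (Cons X Xs)
  have D': "inversion X D \<in> orientations G" using Cons.prems(1) by (rule inversion_in_orientations)
  then obtain p where p: "pre_digraph.awalk (with_proj (inversion_graph G)) (inversion X D) p
      (fold inversion Xs (inversion X D))" "length p \<le> length Xs"
    using Cons.IH[of "inversion X D"] Cons.prems by auto
  show ?case
  proof (cases "inversion X D = D")
    case True
    then show ?thesis using p by (intro exI[of _ p]) simp
  next
    case False
    then have "(D, inversion X D) \<in> parcs (inversion_graph G)"
      using Cons.prems D' by (auto simp: inversion_graph_def)
    then show ?thesis using p Cons.prems
      by (intro exI[of _ "(D, inversion X D) # p"])
         (simp add: pre_digraph.awalk_def pre_digraph.cas.simps inversion_graph_def)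
  qed
qed

lemma awalk_imp_fold_inversion:
  assumes "pre_digraph.awalk (with_proj (inversion_graph G)) D p D'"
  shows "\<exists>Xs. length Xs = length p \<and> fold inversion Xs D = D'"
proof -
  have "set p \<subseteq> parcs (inversion_graph G)" "pre_digraph.cas (with_proj (inversion_graph G)) D p D'"
    using assms by (simp_all add: pre_digraph.awalk_def)
  then show ?thesis
  proof (induction p arbitrary: D)
    case Nil
    then show ?case by (simp add: pre_digraph.cas.simps)
  next
    case (Cons e p)
    then obtain X where X: "inversion X D = snd e"
      by (cases e) (auto simp: pre_digraph.cas.simps inversion_graph_def)
    from Cons obtain Xs where "length Xs = length p" "fold inversion Xs (snd e) = D'"
      by (auto simp: pre_digraph.cas.simps)
    with X show ?case by (intro exI[of _ "X # Xs"]) simp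
  qed
qed

lemma diameter_inversion_graph_leD:
  assumes "pair_graph G" "wf_digraph.diameter (with_proj (inversion_graph G)) \<le> ereal (real C)"
    and "D \<in> orientations G" "D' \<in> orientations G"
  shows "\<exists>Xs. length Xs \<le> C \<and> fold inversion Xs D = D'"
proof -
  interpret I: wf_digraph "with_proj (inversion_graph G)" by (rule wf_inversion_graph[OF assms(1)])
  have "I.\<mu> (\<lambda>_. 1) D D' \<le> I.diameter"
    unfolding I.diameter_def using assms(3,4)
    by (intro SUP_upper2[of D] SUP_upper) (simp_all add: inversion_graph_def)
  \<comment> \<open>The distance is an infimum over walks; the strict bound \<open>Suc C\<close>
    yields an actual walk below it, whose length is an integer and thus at most
    \<open>C\<close>.\<close>
  also have "\<dots> < ereal (real (Suc C))" using assms(2) by (rule le_less_trans) simp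
  finally obtain p where p: "I.awalk D p D'" "ereal (I.awalk_cost (\<lambda>_. 1) p) < ereal (real (Suc C))"
    unfolding I.\<mu>_def INF_less_iff by blast
  from p(2) have "length p \<le> C" by (simp add: I.awalk_cost_1)
  then show ?thesis using awalk_imp_fold_inversion[OF p(1)] by metis
qed

lemma diameter_inversion_graph_leI:
  assumes "pair_graph G"
    and "\<And>D D'. D \<in> orientations G \<Longrightarrow> D' \<in> orientations G \<Longrightarrow>
      \<exists>Xs. \<Union> (set Xs) \<subseteq> pverts G \<and> length Xs \<le> C \<and> fold inversion Xs D = D'"
  shows "wf_digraph.diameter (with_proj (inversion_graph G)) \<le> ereal (real C)"
proof -
  interpret I: wf_digraph "with_proj (inversion_graph G)" by (rule wf_inversion_graph[OF assms(1)])
  show ?thesis unfolding I.diameter_def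
  proof (intro SUP_least)
    fix D D' assume D: "D \<in> verts (with_proj (inversion_graph G))" "D' \<in> verts (with_proj (inversion_graph G))"
    then have D: "D \<in> orientations G" "D' \<in> orientations G" by (simp_all add: inversion_graph_def)
    from assms(2)[OF this] obtain Xs
      where Xs: "\<Union> (set Xs) \<subseteq> pverts G" "length Xs \<le> C" "fold inversion Xs D = D'"
      by (elim exE conjE)
    obtain p where p: "I.awalk D p D'" "length p \<le> length Xs"
      using fold_inversion_imp_awalk[OF assms(1) D(1) Xs(1)] unfolding Xs(3) by (elim exE conjE)
    have "I.\<mu> (\<lambda>_. 1) D D' \<le> ereal (real (length p))"
      using I.min_cost_le_walk_cost[OF p(1), of "\<lambda>_. 1"] by (simp add: I.awalk_cost_1)
    also have "\<dots> \<le> ereal (real C)" using p(2) Xs(2) by simp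
    finally show "I.\<mu> (\<lambda>_. 1) D D' \<le> ereal (real C)" .
  qed
qed

section \<open>Encodings from a bounded diameter\<close>

text \<open>The code of a vertex is the set of indices of the inverted sets that contain it; an edge
  is reversed exactly if the codes of its ends share an odd number of indices.\<close>

lemma diameter_imp_edge_encodable:
  assumes "pair_graph G" "wf_digraph.diameter (with_proj (inversion_graph G)) \<le> ereal (real C)"
  shows "edge_encodable (pverts G) (parcs G) (2 ^ C)"
proof (rule edge_encodableI[of "Pow {..<C}" _ _ _ "\<lambda>A B. odd (card (A \<inter> B))"])
  show "parcs G \<subseteq> pverts G \<times> pverts G" by (rule pair_graph_facts[OF assms(1)])
  fix S assume S: "S \<subseteq> parcs G" "sym S"
  obtain D where D: "D \<in> orientations G" using orientations_nonempty[OF assms(1)] by blast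
  \<comment> \<open>The reference orientation \<open>D\<close> with exactly the edges of
    \<open>S\<close> reversed.\<close>
  define D' where "D' = \<lparr> pverts = pverts G, parcs = {(u, v) \<in> parcs G. (u, v) \<in> S \<longleftrightarrow> (u, v) \<notin> parcs D} \<rparr>"
  have symS: "(u, v) \<in> S \<longleftrightarrow> (v, u) \<in> S" for u v using S(2) by (auto dest: symD)
  note DD = orientationsD(4,5)[OF D]
  have D': "D' \<in> orientations G"
    using DD symS by (auto simp: orientations_def D'_def)
  obtain Xs where Xs: "length Xs \<le> C" "fold inversion Xs D = D'"
    using diameter_inversion_graph_leD[OF assms D D'] by (elim exE conjE)
  define f where "f v = {i. i < length Xs \<and> v \<in> Xs ! i}" for v
  have "f ` pverts G \<subseteq> Pow {..<C}" using Xs(1) by (auto simp: f_def)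
  moreover have "(u, v) \<in> S \<longleftrightarrow> odd (card (f u \<inter> f v))" if uv: "(u, v) \<in> parcs G" for u v
  proof -
    have "f u \<inter> f v = {i. i < length Xs \<and> u \<in> Xs ! i \<and> v \<in> Xs ! i}" by (auto simp: f_def)
    then have "length [X\<leftarrow>Xs. u \<in> X \<and> v \<in> X] = card (f u \<inter> f v)"
      by (simp add: length_filter_conv_card)
    then have "(u, v) \<in> parcs D' \<longleftrightarrow> (if odd (card (f u \<inter> f v)) then (v, u) \<in> parcs D else (u, v) \<in> parcs D)"
      using parcs_fold_inversion[of u v Xs D] unfolding Xs(2) by simp
    moreover have "(u, v) \<in> parcs D' \<longleftrightarrow> ((u, v) \<in> S \<longleftrightarrow> (u, v) \<notin> parcs D)"
      using uv by (simp add: D'_def)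
    ultimately show ?thesis using DD[of u v] uv by (auto split: if_splits)
  qed
  ultimately show "\<exists>f. f ` pverts G \<subseteq> Pow {..<C} \<and>
      (\<forall>(u, v)\<in>parcs G. (u, v) \<in> S \<longleftrightarrow> odd (card (f u \<inter> f v)))"
    by (intro exI[of _ f]) auto
qed (simp_all add: card_Pow)

section \<open>Inversions from acyclic colourings\<close>

text \<open>\<open>F\<close> grows by one pair of colours at a time. The two new sets lie in the
  union of the two classes, so by properness they reverse no edge with another colour pair.
  \<open>min\<close> and \<open>max\<close> express the unordered pair.\<close>

lemma acyclic_colouring_imp_inversions:
  assumes "pair_graph G" and col: "acyclic_colouring G k \<phi>" and "sym S"
    and "finite F" "F \<subseteq> {(i, j). i \<in> {1..k} \<and> j \<in> {1..k} \<and> i < j}"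
  shows "\<exists>Xs. \<Union> (set Xs) \<subseteq> pverts G \<and> length Xs = 2 * card F \<and>
    (\<forall>(u, v)\<in>parcs G. odd (length [X\<leftarrow>Xs. u \<in> X \<and> v \<in> X]) \<longleftrightarrow>
       (u, v) \<in> S \<and> (min (\<phi> u) (\<phi> v), max (\<phi> u) (\<phi> v)) \<in> F)"
  using assms(4,5)
proof (induction F rule: finite_induct)
  case empty
  then show ?case by (intro exI[of _ "[]"]) simp
next
  case (insert p F)
  note G = pair_graph_facts[OF assms(1)]
  obtain i j where p: "p = (i, j)" "i \<in> {1..k}" "j \<in> {1..k}" "i < j"
    using insert.prems by auto
  from insert obtain Xs where Xs: "\<Union> (set Xs) \<subseteq> pverts G" "length Xs = 2 * card F"
    "\<forall>(u, v)\<in>parcs G. odd (length [X\<leftarrow>Xs. u \<in> X \<and> v \<in> X]) \<longleftrightarrow>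
       (u, v) \<in> S \<and> (min (\<phi> u) (\<phi> v), max (\<phi> u) (\<phi> v)) \<in> F"
    by auto
  define W where "W = colour_class G \<phi> i \<union> colour_class G \<phi> j"
  have W: "W \<subseteq> pverts G" by (auto simp: W_def colour_class_def)
  have "undirected_forest (with_proj G \<restriction> W)"
    using col p by (auto simp: acyclic_colouring_def W_def)
  then have "degenerate (parcs G) W 1"
    by (rule undirected_forest_imp_degenerate[OF assms(1) W])
  from degenerate_1_imp_two_inversions[OF finite_subset[OF W G(1)] this G(3,4) assms(3)]
  obtain X Y where XY: "X \<union> Y = W"
    "\<forall>u\<in>W. \<forall>v\<in>W. (u, v) \<in> parcs G \<longrightarrow> ((u, v) \<in> S \<longleftrightarrow> (u \<in> X \<and> v \<in> X) \<noteq> (u \<in> Y \<and> v \<in> Y))"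
    by (elim exE conjE)
  have "odd (length [Z\<leftarrow>X # Y # Xs. u \<in> Z \<and> v \<in> Z]) \<longleftrightarrow>
      (u, v) \<in> S \<and> (min (\<phi> u) (\<phi> v), max (\<phi> u) (\<phi> v)) \<in> insert p F"
    if uv: "(u, v) \<in> parcs G" for u v
  proof -
    have V: "u \<in> pverts G" "v \<in> pverts G" using uv G(2) by auto
    have "\<phi> u \<noteq> \<phi> v" using uv col by (auto simp: acyclic_colouring_def proper_colouring_def)
    have old: "odd (length [Z\<leftarrow>Xs. u \<in> Z \<and> v \<in> Z]) \<longleftrightarrow>
       (u, v) \<in> S \<and> (min (\<phi> u) (\<phi> v), max (\<phi> u) (\<phi> v)) \<in> F"
      using Xs(3) uv by auto
    have new: "odd (length [Z\<leftarrow>X # Y # Xs. u \<in> Z \<and> v \<in> Z]) \<longleftrightarrow>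
        ((u \<in> X \<and> v \<in> X) \<noteq> (u \<in> Y \<and> v \<in> Y)) \<noteq> odd (length [Z\<leftarrow>Xs. u \<in> Z \<and> v \<in> Z])"
      by auto
    have W_iff: "u \<in> W \<and> v \<in> W \<longleftrightarrow> (min (\<phi> u) (\<phi> v), max (\<phi> u) (\<phi> v)) = p"
      using V p(1,4) \<open>\<phi> u \<noteq> \<phi> v\<close> by (auto simp: W_def colour_class_def min_def max_def)
    show ?thesis
    proof (cases "u \<in> W \<and> v \<in> W")
      case True
      then have "(u, v) \<in> S \<longleftrightarrow> (u \<in> X \<and> v \<in> X) \<noteq> (u \<in> Y \<and> v \<in> Y)"
        using XY(2) uv by simp
      \<comment> \<open>As \<open>p \<notin> F\<close>, the earlier sets reverse this edge an even
        number of times, so \<open>X\<close> and \<open>Y\<close> alone decide.\<close>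
      then show ?thesis using True W_iff insert.hyps(2) unfolding new old by simp
    next
      case False
      then have "\<not> (u \<in> X \<and> v \<in> X)" "\<not> (u \<in> Y \<and> v \<in> Y)" using XY(1) by auto
      then show ?thesis using False W_iff unfolding new old by auto
    qed
  qed
  moreover have "\<Union> (set (X # Y # Xs)) \<subseteq> pverts G" using Xs(1) XY(1) W by auto
  moreover have "length (X # Y # Xs) = 2 * card (insert p F)"
    using insert.hyps Xs(2) by simp
  ultimately show ?case by (intro exI[of _ "X # Y # Xs"] conjI ballI) (simp_all only: split_paired_all prod.case)
qed

text \<open>With \<open>F\<close> consisting of all colour pairs, at most \<open>k * k\<close> many,
  and \<open>S\<close> of the edges on which \<open>D\<close> and \<open>D'\<close> disagree, two
  inversions per pair turn \<open>D\<close> into \<open>D'\<close>.\<close>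

lemma diameter_le_acyclic_chromatic_number:
  assumes "pair_graph G" "acyclic_chromatic_number G \<le> k"
  shows "wf_digraph.diameter (with_proj (inversion_graph G)) \<le> ereal (real (2 * (k * k)))"
proof (rule diameter_inversion_graph_leI[OF assms(1)])
  fix D D' assume D: "D \<in> orientations G" and D': "D' \<in> orientations G"
  note G = pair_graph_facts[OF assms(1)]
  define m where "m = acyclic_chromatic_number G"
  obtain \<phi> where \<phi>: "acyclic_colouring G m \<phi>"
    using acyclic_colouring_acyclic_chromatic_number[OF assms(1)] unfolding m_def by blast
  define S where "S = {(u, v) \<in> parcs G. (u, v) \<in> parcs D \<longleftrightarrow> (u, v) \<notin> parcs D'}"
  note DD = orientationsD(4,5)[OF D] orientationsD(4,5)[OF D']
  have "sym S"
    using DD symD[OF G(3)] unfolding S_def by (intro symI) blast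
  define F where "F = {(i, j). i \<in> {1..m} \<and> j \<in> {1..m} \<and> i < j}"
  have F: "F \<subseteq> {1..m} \<times> {1..m}" by (auto simp: F_def)
  then have "finite F" by (rule finite_subset) simp
  have "card F \<le> m * m" using card_mono[OF _ F] by (simp add: card_cartesian_product)
  also have "\<dots> \<le> k * k" using assms(2) by (intro mult_le_mono) (simp_all add: m_def)
  finally have cF: "card F \<le> k * k" .
  obtain Xs where Xs: "\<Union> (set Xs) \<subseteq> pverts G" "length Xs = 2 * card F"
    "\<forall>(u, v)\<in>parcs G. odd (length [X\<leftarrow>Xs. u \<in> X \<and> v \<in> X]) \<longleftrightarrow>
       (u, v) \<in> S \<and> (min (\<phi> u) (\<phi> v), max (\<phi> u) (\<phi> v)) \<in> F"
    using acyclic_colouring_imp_inversions[OF assms(1) \<phi> \<open>sym S\<close> \<open>finite F\<close>]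
    unfolding F_def by blast
  have "(u, v) \<in> parcs (fold inversion Xs D) \<longleftrightarrow> (u, v) \<in> parcs D'" for u v
  proof (cases "(u, v) \<in> parcs G")
    case True
    have "u \<in> pverts G" "v \<in> pverts G" using True G(2) by auto
    then have "(min (\<phi> u) (\<phi> v), max (\<phi> u) (\<phi> v)) \<in> F"
      using \<phi> True by (auto simp: F_def acyclic_colouring_def proper_colouring_def min_def max_def)
    then have "odd (length [X\<leftarrow>Xs. u \<in> X \<and> v \<in> X]) \<longleftrightarrow> (u, v) \<in> S"
      using Xs(3) True by auto
    then show ?thesis
      unfolding parcs_fold_inversion using True DD[of u v] by (auto simp: S_def)
  next
    case False
    then show ?thesis unfolding parcs_fold_inversion using DD[of u v] by auto
  qed
  then have "parcs (fold inversion Xs D) = parcs D'" by auto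
  moreover have "pverts (fold inversion Xs D) = pverts D'"
    using orientationsD(1)[OF D] orientationsD(1)[OF D'] by (simp add: pverts_fold_inversion)
  ultimately have "fold inversion Xs D = D'" by simp
  then show "\<exists>Xs. \<Union> (set Xs) \<subseteq> pverts G \<and> length Xs \<le> 2 * (k * k) \<and> fold inversion Xs D = D'"
    using Xs(1,2) cF by (intro exI[of _ Xs]) simp
qed

theorem theorem1p2:
  fixes \<G> :: "'a pair_pre_digraph set"
  assumes "\<And>G. G \<in> \<G> \<Longrightarrow> pair_graph G"
  defines "bounded_diam \<equiv>
      \<exists>C::nat. \<forall>G\<in>\<G>. wf_digraph.diameter (with_proj (inversion_graph G)) \<le> ereal (real C)"
    and "bounded_star \<equiv> \<exists>C\<^sub>s::nat. \<forall>G\<in>\<G>. star_chromatic_number G \<le> C\<^sub>s"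
    and "bounded_acyclic \<equiv> \<exists>C\<^sub>a::nat. \<forall>G\<in>\<G>. acyclic_chromatic_number G \<le> C\<^sub>a"
    and "bounded_oriented \<equiv> \<exists>C\<^sub>o::nat. \<forall>G\<in>\<G>. oriented_chromatic_number G \<le> C\<^sub>o"
  shows "(bounded_diam \<longleftrightarrow> bounded_star) \<and> (bounded_star \<longleftrightarrow> bounded_acyclic) \<and>
         (bounded_acyclic \<longleftrightarrow> bounded_oriented)"
proof -
  have "bounded_acyclic" if bounded_star
    using that acyclic_chromatic_number_le_star[OF assms(1)]
    unfolding bounded_star_def bounded_acyclic_def by (meson order_trans)
  moreover have "bounded_diam" if bounded_acyclic
    using that diameter_le_acyclic_chromatic_number[OF assms(1)]
    unfolding bounded_acyclic_def bounded_diam_def by blast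
  moreover have "bounded_oriented" if bounded_diam
    using that oriented_chromatic_number_le[OF assms(1) diameter_imp_edge_encodable[OF assms(1)]]
    unfolding bounded_diam_def bounded_oriented_def by blast
  moreover have "bounded_star" if bounded_oriented
    using that star_chromatic_number_le[OF assms(1) oriented_chromatic_number_imp_edge_encodable[OF assms(1)]]
    unfolding bounded_oriented_def bounded_star_def by blast
  ultimately show ?thesis by blast
qed

end
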